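(* Let $A,B$ be groups, $C,C'$ proper subgroups of $A$ and $B$ respectively, $\varphi:C\to C'$ an isomorphism, and let $$G=A*_CB=\langle A,B\mid c=\varphi(c)\ \text{for all } c\in C\rangle$$ be the amalgamated product. Identify $C$ with a subgroup of both $A$ and $B$, and let $\widetilde C$ be the largest subgroup of $C$ that is normal in $G$. - If the amalgam is non-degenerate, then $G$ is icc if and only if (i) $FC_G(\widetilde C)=\{1\}$. - If the amalgam is degenerate, then $\widetilde C=C$, $G$ decomposes as an extension $$1\longrightarrow C\longrightarrow G\longrightarrow \mathbb{Z}/2\mathbb{Z}*\mathbb{Z}/2\mathbb{Z}\longrightarrow 1,$$ and $G$ is icc if and only if both (i) $FC_G(\widetilde C)=\{1\}$ holds and (ii) the associated coupling $\Theta:\mathbb{Z}/2\mathbb{Z}*\mathbb{Z}/2\mathbb{Z}\to\mathrm{Out}(C)$ is injective.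
   Context: A group is icc if it is infinite and all of its conjugacy classes except $\{1\}$ are infinite. The amalgam is called degenerate when $C$ and $C'$ have index $2$ in $A$ and $B$ respectively, and non-degenerate otherwise. For a normal subgroup $N$ of $G$, $FC_G(N)$ is the set of elements of $N$ whose $G$-conjugacy class is finite. The coupling of an extension $1\to K\to G\to Q\to 1$ is the homomorphism $Q\to\mathrm{Out}(K)$ sending $q$ to the class of $x\mapsto gxg^{-1}$, for any preimage $g\in G$ of $q$. *)

theory Defs
  imports "HOL-Algebra.Algebra"
begin

subsection \<open>Conjugacy classes, icc groups, \<open>FC\<^sub>G(N)\<close>\<close>

definition conj_class :: "('a, 'm) monoid_scheme \<Rightarrow> 'a \<Rightarrow> 'a set"
  where "conj_class G x = {g \<otimes>\<^bsub>G\<^esub> x \<otimes>\<^bsub>G\<^esub> inv\<^bsub>G\<^esub> g | g. g \<in> carrier G}"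

definition icc :: "('a, 'm) monoid_scheme \<Rightarrow> bool"
  where "icc G \<longleftrightarrow> infinite (carrier G) \<and>
           (\<forall>x \<in> carrier G. x \<noteq> \<one>\<^bsub>G\<^esub> \<longrightarrow> infinite (conj_class G x))"

definition FC :: "('a, 'm) monoid_scheme \<Rightarrow> 'a set \<Rightarrow> 'a set"
  where "FC G N = {x \<in> N. finite (conj_class G x)}"

definition largest_normal_within :: "('a, 'm) monoid_scheme \<Rightarrow> 'a set \<Rightarrow> 'a set"
  where "largest_normal_within G H = (GREATEST N. N \<lhd> G \<and> N \<subseteq> H)"


subsection \<open>Free products with identifications\<close>

text \<open>
  The group with presentation \<open>\<langle>A, B | c = d for all (c, d) \<in> R\<rangle>\<close> consists of the words in the
  disjoint union of \<open>A\<close> and \<open>B\<close> modulo the congruence generated by the multiplication tables of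
  \<open>A\<close> and \<open>B\<close> and the identifications \<open>R\<close>. Inverses of letters are letters, so monoid words suffice.
\<close>

definition letters :: "('a, 'm) monoid_scheme \<Rightarrow> ('b, 'n) monoid_scheme \<Rightarrow> ('a + 'b) set"
  where "letters A B = Inl ` carrier A \<union> Inr ` carrier B"

inductive_set word_cong ::
    "('a, 'm) monoid_scheme \<Rightarrow> ('b, 'n) monoid_scheme \<Rightarrow> ('a \<times> 'b) set \<Rightarrow>
      (('a + 'b) list \<times> ('a + 'b) list) set"
  for A :: "('a, 'm) monoid_scheme" and B :: "('b, 'n) monoid_scheme" and R
where
  wc_refl: "w \<in> lists (letters A B) \<Longrightarrow> (w, w) \<in> word_cong A B R"
| wc_sym: "(u, v) \<in> word_cong A B R \<Longrightarrow> (v, u) \<in> word_cong A B R"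
| wc_trans: "\<lbrakk>(u, v) \<in> word_cong A B R; (v, w) \<in> word_cong A B R\<rbrakk> \<Longrightarrow> (u, w) \<in> word_cong A B R"
| wc_append: "\<lbrakk>(u, u') \<in> word_cong A B R; (v, v') \<in> word_cong A B R\<rbrakk>
    \<Longrightarrow> (u @ v, u' @ v') \<in> word_cong A B R"
| wc_one1: "([Inl \<one>\<^bsub>A\<^esub>], []) \<in> word_cong A B R"
| wc_one2: "([Inr \<one>\<^bsub>B\<^esub>], []) \<in> word_cong A B R"
| wc_mult1: "\<lbrakk>x \<in> carrier A; y \<in> carrier A\<rbrakk>
    \<Longrightarrow> ([Inl x, Inl y], [Inl (x \<otimes>\<^bsub>A\<^esub> y)]) \<in> word_cong A B R"
| wc_mult2: "\<lbrakk>x \<in> carrier B; y \<in> carrier B\<rbrakk>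
    \<Longrightarrow> ([Inr x, Inr y], [Inr (x \<otimes>\<^bsub>B\<^esub> y)]) \<in> word_cong A B R"
| wc_ident: "\<lbrakk>(c, d) \<in> R; c \<in> carrier A; d \<in> carrier B\<rbrakk>
    \<Longrightarrow> ([Inl c], [Inr d]) \<in> word_cong A B R"

definition free_product_ident ::
    "('a, 'm) monoid_scheme \<Rightarrow> ('b, 'n) monoid_scheme \<Rightarrow> ('a \<times> 'b) set \<Rightarrow> ('a + 'b) list set monoid"
  where "free_product_ident A B R =
    \<lparr>carrier = lists (letters A B) // word_cong A B R,
     monoid.mult = (\<lambda>S T. \<Union>u\<in>S. \<Union>v\<in>T. word_cong A B R `` {u @ v}),
     one = word_cong A B R `` {[]}\<rparr>"

definition fpi_inl ::
    "('a, 'm) monoid_scheme \<Rightarrow> ('b, 'n) monoid_scheme \<Rightarrow> ('a \<times> 'b) set \<Rightarrow> 'a \<Rightarrow> ('a + 'b) list set"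
  where "fpi_inl A B R a = word_cong A B R `` {[Inl a]}"

definition fpi_inr ::
    "('a, 'm) monoid_scheme \<Rightarrow> ('b, 'n) monoid_scheme \<Rightarrow> ('a \<times> 'b) set \<Rightarrow> 'b \<Rightarrow> ('a + 'b) list set"
  where "fpi_inr A B R b = word_cong A B R `` {[Inr b]}"

definition amalgamated_product ::
    "('a, 'm) monoid_scheme \<Rightarrow> ('b, 'n) monoid_scheme \<Rightarrow> 'a set \<Rightarrow> ('a \<Rightarrow> 'b)
      \<Rightarrow> ('a + 'b) list set monoid"
  where "amalgamated_product A B C \<phi> = free_product_ident A B ((\<lambda>c. (c, \<phi> c)) ` C)"

definition amalg_inl ::
    "('a, 'm) monoid_scheme \<Rightarrow> ('b, 'n) monoid_scheme \<Rightarrow> 'a set \<Rightarrow> ('a \<Rightarrow> 'b)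
      \<Rightarrow> 'a \<Rightarrow> ('a + 'b) list set"
  where "amalg_inl A B C \<phi> = fpi_inl A B ((\<lambda>c. (c, \<phi> c)) ` C)"

definition free_product ::
    "('a, 'm) monoid_scheme \<Rightarrow> ('b, 'n) monoid_scheme \<Rightarrow> ('a + 'b) list set monoid"
  where "free_product A B = free_product_ident A B {}"

text \<open>\<open>card\<close> is \<open>0\<close> on infinite sets, so this does say that both indices are finite and equal to 2.\<close>

definition degenerate_amalgam ::
    "('a, 'm) monoid_scheme \<Rightarrow> ('b, 'n) monoid_scheme \<Rightarrow> 'a set \<Rightarrow> 'b set \<Rightarrow> bool"
  where "degenerate_amalgam A B C C' \<longleftrightarrow> card (rcosets\<^bsub>A\<^esub> C) = 2 \<and> card (rcosets\<^bsub>B\<^esub> C') = 2"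


subsection \<open>Outer automorphisms, extensions and their couplings\<close>

definition Inn :: "('a, 'm) monoid_scheme \<Rightarrow> ('a \<Rightarrow> 'a) set"
  where "Inn K = {\<lambda>x \<in> carrier K. k \<otimes>\<^bsub>K\<^esub> x \<otimes>\<^bsub>K\<^esub> inv\<^bsub>K\<^esub> k | k. k \<in> carrier K}"

definition Out :: "('a, 'm) monoid_scheme \<Rightarrow> ('a \<Rightarrow> 'a) set monoid"
  where "Out K = AutoGroup K Mod Inn K"

text \<open>
  Short exact sequences \<open>1 \<rightarrow> K \<rightarrow> G \<rightarrow> Q \<rightarrow> 1\<close> with maps \<open>i\<close> and \<open>p\<close>; the library's \<open>exact_seq\<close>
  needs all groups to have elements of the same type.
\<close>

definition group_extension ::
    "('k, 'l) monoid_scheme \<Rightarrow> ('k \<Rightarrow> 'g) \<Rightarrow> ('g, 'm) monoid_scheme \<Rightarrow> ('g \<Rightarrow> 'q)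
      \<Rightarrow> ('q, 'n) monoid_scheme \<Rightarrow> bool"
  where "group_extension K i G p Q \<longleftrightarrow>
    group_hom K G i \<and> group_hom G Q p \<and>
    inj_on i (carrier K) \<and> kernel G Q p = i ` carrier K \<and> p ` carrier G = carrier Q"

definition conj_auto ::
    "('k, 'l) monoid_scheme \<Rightarrow> ('k \<Rightarrow> 'g) \<Rightarrow> ('g, 'm) monoid_scheme \<Rightarrow> 'g \<Rightarrow> 'k \<Rightarrow> 'k"
  where "conj_auto K i G g =
    (\<lambda>x \<in> carrier K. inv_into (carrier K) i (g \<otimes>\<^bsub>G\<^esub> i x \<otimes>\<^bsub>G\<^esub> inv\<^bsub>G\<^esub> g))"

text \<open>
  The preimage of \<open>q\<close> is chosen by \<open>inv_into\<close>; lemma \<open>coupling_eq\<close> below shows that the choice is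
  irrelevant.
\<close>

definition coupling ::
    "('k, 'l) monoid_scheme \<Rightarrow> ('k \<Rightarrow> 'g) \<Rightarrow> ('g, 'm) monoid_scheme \<Rightarrow> ('g \<Rightarrow> 'q)
      \<Rightarrow> 'q \<Rightarrow> ('k \<Rightarrow> 'k) set"
  where "coupling K i G p q = Inn K #>\<^bsub>AutoGroup K\<^esub> conj_auto K i G (inv_into (carrier G) p q)"


subsection \<open>The largest normal subgroup exists\<close>

lemma largest_normal_within_eq:
  fixes G (structure)
  assumes "group G" "subgroup H G"
  defines "M \<equiv> {h. h \<in> carrier G \<and> (\<forall>g\<in>carrier G. g \<otimes> h \<otimes> inv g \<in> H)}"
  shows "largest_normal_within G H = M"
    and "M \<lhd> G" and "M \<subseteq> H" and "\<And>N. N \<lhd> G \<Longrightarrow> N \<subseteq> H \<Longrightarrow> N \<subseteq> M"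
proof -
  interpret group G by fact
  interpret H: subgroup H G by fact
  show M_H: "M \<subseteq> H"
  proof
    fix h assume "h \<in> M"
    then have "h \<in> carrier G" "\<one> \<otimes> h \<otimes> inv \<one> \<in> H" unfolding M_def by blast+
    then show "h \<in> H" by simp
  qed
  have sub: "subgroup M G"
  proof (rule subgroupI)
    show "M \<subseteq> carrier G" by (auto simp: M_def)
    have "\<one> \<in> M" by (auto simp: M_def)
    then show "M \<noteq> {}" by blast
  next
    fix h assume h: "h \<in> M"
    have "g \<otimes> inv h \<otimes> inv g = inv (g \<otimes> h \<otimes> inv g)" if "g \<in> carrier G" for g
      using h that by (simp add: M_def inv_mult_group m_assoc)
    with h show "inv h \<in> M" by (simp add: M_def)
  next
    fix h k assume hk: "h \<in> M" "k \<in> M"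
    have "g \<otimes> (h \<otimes> k) \<otimes> inv g = (g \<otimes> h \<otimes> inv g) \<otimes> (g \<otimes> k \<otimes> inv g)"
      if g: "g \<in> carrier G" for g
    proof -
      have "inv g \<otimes> (g \<otimes> (k \<otimes> inv g)) = k \<otimes> inv g"
        using hk g by (simp add: M_def flip: m_assoc)
      then show ?thesis using hk g by (simp add: M_def m_assoc)
    qed
    with hk show "h \<otimes> k \<in> M" by (simp add: M_def)
  qed
  show M_n: "M \<lhd> G"
  proof (subst normal_inv_iff, intro conjI ballI sub)
    fix x h assume x: "x \<in> carrier G" and h: "h \<in> M"
    have "g \<otimes> (x \<otimes> h \<otimes> inv x) \<otimes> inv g = (g \<otimes> x) \<otimes> h \<otimes> inv (g \<otimes> x)"
      if "g \<in> carrier G" for g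
      using h x that by (simp add: M_def inv_mult_group m_assoc)
    with x h show "x \<otimes> h \<otimes> inv x \<in> M" by (simp add: M_def)
  qed
  show max: "N \<subseteq> M" if "N \<lhd> G" "N \<subseteq> H" for N
    using that by (auto simp: M_def normal_inv_iff dest: subgroup.mem_carrier)
  show "largest_normal_within G H = M"
    unfolding largest_normal_within_def
    by (rule Greatest_equality) (use M_n M_H max in auto)
qed


subsection \<open>Free products with identifications: group structure and universal property\<close>

lemma word_cong_words:
  assumes "group A" "group B" "(u, v) \<in> word_cong A B R"
  shows "u \<in> lists (letters A B)" "v \<in> lists (letters A B)"
proof -
  interpret A: group A by fact
  interpret B: group B by fact
  have "u \<in> lists (letters A B) \<and> v \<in> lists (letters A B)"
    using assms(3) by (induction rule: word_cong.induct) (auto simp: letters_def)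
  then show "u \<in> lists (letters A B)" "v \<in> lists (letters A B)" by auto
qed

context
  fixes A :: "('a, 'm) monoid_scheme" and B :: "('b, 'n) monoid_scheme" and R :: "('a \<times> 'b) set"
  assumes A: "group A" and B: "group B"
begin

interpretation A: group A by (rule A)
interpretation B: group B by (rule B)

private abbreviation "W \<equiv> lists (letters A B)"
private abbreviation "E \<equiv> word_cong A B R"
private abbreviation "P \<equiv> free_product_ident A B R"

lemma equiv_word_cong: "equiv W E"
proof (rule equivI)
  show "E \<subseteq> W \<times> W" by (auto dest: word_cong_words[OF A B])
  show "refl_on W E" by (auto simp: refl_on_def intro: wc_refl)
  show "sym E" by (auto simp: sym_def intro: wc_sym)
  show "trans E" by (auto simp: trans_def intro: wc_trans)
qed

lemma fpi_carrier: "carrier P = (\<lambda>w. E `` {w}) ` W"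
  by (auto simp: free_product_ident_def quotient_def)

lemma fpi_class_eq: "(u, v) \<in> E \<Longrightarrow> E `` {u} = E `` {v}"
  using equiv_word_cong by (rule equiv_class_eq)

lemma fpi_mult:
  assumes "u \<in> W" "v \<in> W"
  shows "E `` {u} \<otimes>\<^bsub>P\<^esub> E `` {v} = E `` {u @ v}"
proof -
  have "E `` {u' @ v'} = E `` {u @ v}" if "(u, u') \<in> E" "(v, v') \<in> E" for u' v'
    using fpi_class_eq[OF wc_append[OF that]] by simp
  then have "(\<Union>u'\<in>E `` {u}. \<Union>v'\<in>E `` {v}. E `` {u' @ v'}) = E `` {u @ v}"
    using wc_refl[OF assms(1), of R] wc_refl[OF assms(2), of R] by blast
  then show ?thesis by (simp add: free_product_ident_def)
qed

lemma fpi_one: "\<one>\<^bsub>P\<^esub> = E `` {[]}"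
  by (simp add: free_product_ident_def)

lemma fpi_inverse_word: "w \<in> W \<Longrightarrow> \<exists>w'\<in>W. (w' @ w, []) \<in> E"
proof (induction w)
  case Nil
  then show ?case by (intro bexI[of _ "[]"]) (auto intro: wc_refl)
next
  case (Cons l w)
  then obtain w' where w': "w' \<in> W" "(w' @ w, []) \<in> E" by auto
  have "\<exists>l'\<in>letters A B. ([l', l], []) \<in> E"
  proof (cases l)
    case (Inl a)
    with Cons have a: "a \<in> carrier A" by (auto simp: letters_def)
    have "([Inl (inv\<^bsub>A\<^esub> a), Inl a], []) \<in> E"
      using wc_trans[OF wc_mult1[of "inv\<^bsub>A\<^esub> a" A a] _] a wc_one1 by fastforce
    with a Inl show ?thesis by (intro bexI[of _ "Inl (inv\<^bsub>A\<^esub> a)"]) (auto simp: letters_def)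
  next
    case (Inr b)
    with Cons have b: "b \<in> carrier B" by (auto simp: letters_def)
    have "([Inr (inv\<^bsub>B\<^esub> b), Inr b], []) \<in> E"
      using wc_trans[OF wc_mult2[of "inv\<^bsub>B\<^esub> b" B b] _] b wc_one2 by fastforce
    with b Inr show ?thesis by (intro bexI[of _ "Inr (inv\<^bsub>B\<^esub> b)"]) (auto simp: letters_def)
  qed
  then obtain l' where l': "l' \<in> letters A B" "([l', l], []) \<in> E" by blast
  have "(w' @ [l', l] @ w, w' @ [] @ w) \<in> E"
    using Cons.prems w' l' by (intro wc_append wc_refl) auto
  with w'(2) have "((w' @ [l']) @ l # w, []) \<in> E"
    using wc_trans by fastforce
  with w' l' show ?case by (intro bexI[of _ "w' @ [l']"]) auto
qed

theorem group_free_product_ident: "group P"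
proof (rule groupI)
  show "\<one>\<^bsub>P\<^esub> \<in> carrier P" by (auto simp: fpi_carrier fpi_one)
  show "x \<otimes>\<^bsub>P\<^esub> y \<in> carrier P" if "x \<in> carrier P" "y \<in> carrier P" for x y
    using that by (auto simp: fpi_carrier fpi_mult del: in_listsD intro!: imageI)
  show "x \<otimes>\<^bsub>P\<^esub> y \<otimes>\<^bsub>P\<^esub> z = x \<otimes>\<^bsub>P\<^esub> (y \<otimes>\<^bsub>P\<^esub> z)"
    if "x \<in> carrier P" "y \<in> carrier P" "z \<in> carrier P" for x y z
    using that by (auto simp: fpi_carrier fpi_mult del: in_listsD)
  show "\<one>\<^bsub>P\<^esub> \<otimes>\<^bsub>P\<^esub> x = x" if "x \<in> carrier P" for x
    using that by (auto simp: fpi_carrier fpi_mult fpi_one del: in_listsD)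
  show "\<exists>y\<in>carrier P. y \<otimes>\<^bsub>P\<^esub> x = \<one>\<^bsub>P\<^esub>" if "x \<in> carrier P" for x
  proof -
    obtain w where w: "w \<in> W" "x = E `` {w}" using \<open>x \<in> carrier P\<close> by (auto simp: fpi_carrier)
    obtain w' where w': "w' \<in> W" "(w' @ w, []) \<in> E" using fpi_inverse_word[OF w(1)] by blast
    show ?thesis
      using w w' fpi_class_eq[OF w'(2)]
      by (intro bexI[of _ "E `` {w'}"]) (auto simp: fpi_mult fpi_one fpi_carrier)
  qed
qed

lemma fpi_inl_hom: "fpi_inl A B R \<in> hom A P"
proof (rule homI)
  fix x y assume "x \<in> carrier A" "y \<in> carrier A"
  then show "fpi_inl A B R (x \<otimes>\<^bsub>A\<^esub> y) = fpi_inl A B R x \<otimes>\<^bsub>P\<^esub> fpi_inl A B R y"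
    using fpi_class_eq[OF wc_mult1[of x A y B R]] by (simp add: fpi_inl_def fpi_mult letters_def)
qed (auto simp: fpi_inl_def fpi_carrier letters_def)

lemma fpi_inr_hom: "fpi_inr A B R \<in> hom B P"
proof (rule homI)
  fix x y assume "x \<in> carrier B" "y \<in> carrier B"
  then show "fpi_inr A B R (x \<otimes>\<^bsub>B\<^esub> y) = fpi_inr A B R x \<otimes>\<^bsub>P\<^esub> fpi_inr A B R y"
    using fpi_class_eq[OF wc_mult2[of x B y A R]] by (simp add: fpi_inr_def fpi_mult letters_def)
qed (auto simp: fpi_inr_def fpi_carrier letters_def)

lemma fpi_ident:
  "(c, d) \<in> R \<Longrightarrow> c \<in> carrier A \<Longrightarrow> d \<in> carrier B \<Longrightarrow> fpi_inl A B R c = fpi_inr A B R d"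
  unfolding fpi_inl_def fpi_inr_def by (intro fpi_class_eq wc_ident)

theorem fpi_universal:
  assumes H: "group H" and f: "f \<in> hom A H" and g: "g \<in> hom B H"
    and R: "\<And>c d. (c, d) \<in> R \<Longrightarrow> c \<in> carrier A \<Longrightarrow> d \<in> carrier B \<Longrightarrow> f c = g d"
  obtains h where "h \<in> hom P H"
    "\<And>a. a \<in> carrier A \<Longrightarrow> h (fpi_inl A B R a) = f a"
    "\<And>b. b \<in> carrier B \<Longrightarrow> h (fpi_inr A B R b) = g b"
    "\<And>h' x. \<lbrakk>h' \<in> hom P H; x \<in> carrier P;
        \<And>a. a \<in> carrier A \<Longrightarrow> h' (fpi_inl A B R a) = f a;
        \<And>b. b \<in> carrier B \<Longrightarrow> h' (fpi_inr A B R b) = g b\<rbrakk> \<Longrightarrow> h' x = h x"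
proof -
  interpret H: group H by fact
  define ev where "ev = foldr (\<lambda>l y. case_sum f g l \<otimes>\<^bsub>H\<^esub> y)"
  define evl where "evl w = ev w \<one>\<^bsub>H\<^esub>" for w
  have letter: "case_sum f g l \<in> carrier H" if "l \<in> letters A B" for l
    using that f g by (auto simp: letters_def hom_def)
  have closed: "evl w \<in> carrier H" if "w \<in> W" for w
    using that by (induction w) (auto simp: evl_def ev_def letter)
  have append: "evl (u @ v) = evl u \<otimes>\<^bsub>H\<^esub> evl v" if "u \<in> W" "v \<in> W" for u v
    using that(1) 
  proof (induction u)
    case Nil
    then show ?case using closed[OF that(2)] by (simp add: evl_def ev_def)
  next
    case (Cons l u)
    then show ?case using closed[of u] closed[OF that(2)] letter[of l]
      by (simp add: evl_def ev_def H.m_assoc)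
  qed
  have f1: "f \<one>\<^bsub>A\<^esub> = \<one>\<^bsub>H\<^esub>" and g1: "g \<one>\<^bsub>B\<^esub> = \<one>\<^bsub>H\<^esub>"
    using hom_one[OF f A H] hom_one[OF g B H] by auto
  have cong: "evl u = evl v" if "(u, v) \<in> E" for u v
    using that
  proof (induction rule: word_cong.induct)
    case (wc_append u u' v v')
    then show ?case
      using word_cong_words[OF A B wc_append.hyps(1)] word_cong_words[OF A B wc_append.hyps(2)]
      by (simp add: append)
  next
    case (wc_mult1 x y)
    then show ?case using f by (simp add: evl_def ev_def hom_def Pi_iff)
  next
    case (wc_mult2 x y)
    then show ?case using g by (simp add: evl_def ev_def hom_def Pi_iff)
  next
    case (wc_ident c d)
    then show ?case using R by (simp add: evl_def ev_def)
  qed (simp_all add: evl_def ev_def f1 g1)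
  define h where "h S = evl (SOME w. w \<in> S)" for S
  have h_class: "h (E `` {w}) = evl w" if "w \<in> W" for w
  proof -
    have "(SOME v. v \<in> E `` {w}) \<in> E `` {w}"
      using wc_refl[OF that, of R] by (intro someI[of "\<lambda>v. v \<in> E `` {w}" w]) auto
    then show ?thesis unfolding h_def using cong[of w] by simp
  qed
  show thesis
  proof (rule that)
    show "h \<in> hom P H"
      by (rule homI) (auto simp: fpi_carrier fpi_mult h_class closed append del: in_listsD)
    show hl: "h (fpi_inl A B R a) = f a" if a: "a \<in> carrier A" for a
      using a f h_class[of "[Inl a]"] hom_in_carrier[OF f] by (auto simp: fpi_inl_def letters_def evl_def ev_def hom_def)
    show hr: "h (fpi_inr A B R b) = g b" if b: "b \<in> carrier B" for b
      using b g h_class[of "[Inr b]"] hom_in_carrier[OF g] by (auto simp: fpi_inr_def letters_def evl_def ev_def hom_def)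
    fix h' x
    assume h': "h' \<in> hom P H" and x: "x \<in> carrier P"
      and l: "\<And>a. a \<in> carrier A \<Longrightarrow> h' (fpi_inl A B R a) = f a"
      and r: "\<And>b. b \<in> carrier B \<Longrightarrow> h' (fpi_inr A B R b) = g b"
    have "h' (E `` {w}) = evl w" if "w \<in> W" for w
      using that
    proof (induction w)
      case Nil
      then show ?case using hom_one[OF h' group_free_product_ident H]
        by (simp add: fpi_one evl_def ev_def)
    next
      case (Cons k w)
      then have "E `` {[k]} \<in> carrier P" "E `` {w} \<in> carrier P" by (auto simp: fpi_carrier)
      then have "h' (E `` {k # w}) = h' (E `` {[k]}) \<otimes>\<^bsub>H\<^esub> h' (E `` {w})"
        using Cons fpi_mult[of "[k]" w] hom_mult[OF h', of "E `` {[k]}" "E `` {w}"] by simp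
      also have "h' (E `` {[k]}) = case_sum f g k"
        using Cons.hyps l r by (auto simp: letters_def fpi_inl_def fpi_inr_def)
      finally show ?case using Cons by (simp add: evl_def ev_def)
    qed
    with x show "h' x = h x" by (auto simp: fpi_carrier h_class del: in_listsD)
  qed
qed

end

subsection \<open>The coupling is a well-defined homomorphism\<close>

lemma (in group) inner_mult:
  assumes "k \<in> carrier G" "x \<in> carrier G" "y \<in> carrier G"
  shows "k \<otimes> (x \<otimes> y) \<otimes> inv k = (k \<otimes> x \<otimes> inv k) \<otimes> (k \<otimes> y \<otimes> inv k)"
proof -
  have "inv k \<otimes> (k \<otimes> (y \<otimes> inv k)) = y \<otimes> inv k"
    using assms by (simp flip: m_assoc)
  then show ?thesis using assms by (simp add: m_assoc)
qed

lemma AutoGroup_carrier: "carrier (AutoGroup K) = auto K"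
  by (simp add: AutoGroup_def)

lemma AutoGroup_mult:
  "\<alpha> \<in> auto K \<Longrightarrow> \<beta> \<in> auto K \<Longrightarrow> \<alpha> \<otimes>\<^bsub>AutoGroup K\<^esub> \<beta> = compose (carrier K) \<alpha> \<beta>"
  by (simp add: AutoGroup_def BijGroup_def auto_def)

lemma (in group) Inn_normal: "Inn G \<lhd> AutoGroup G"
proof -
  define \<kappa> where "\<kappa> k = (\<lambda>x \<in> carrier G. k \<otimes> x \<otimes> inv k)" for k
  interpret Au: group "AutoGroup G" by (rule AutoGroup)
  interpret act: group_action G "carrier G" \<kappa>
    unfolding \<kappa>_def by (rule action_by_conjugation)
  have \<kappa>_hom: "\<kappa> \<in> hom G (BijGroup (carrier G))"
    using act.group_hom by (simp add: group_hom_def group_hom_axioms_def)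
  have \<kappa>_auto: "\<kappa> k \<in> auto G" if "k \<in> carrier G" for k
    using that inner_mult[of k] hom_in_carrier[OF \<kappa>_hom that]
    by (auto simp: auto_def \<kappa>_def BijGroup_def intro!: homI)
  have \<kappa>_hom': "\<kappa> \<in> hom G (AutoGroup G)"
    using \<kappa>_hom \<kappa>_auto by (auto simp: hom_def AutoGroup_def)
  interpret \<kappa>: group_hom G "AutoGroup G" \<kappa>
    by unfold_locales (rule \<kappa>_hom')
  have Inn: "Inn G = \<kappa> ` carrier G"
    by (auto simp: Inn_def \<kappa>_def)
  show ?thesis
  proof (subst Au.normal_inv_iff, intro conjI ballI)
    show "subgroup (Inn G) (AutoGroup G)"
      unfolding Inn by (rule \<kappa>.img_is_subgroup)
    fix \<alpha> \<beta> assume a: "\<alpha> \<in> carrier (AutoGroup G)" and "\<beta> \<in> Inn G"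
    then obtain k where k: "k \<in> carrier G" and \<beta>: "\<beta> = \<kappa> k" by (auto simp: Inn)
    have \<alpha>: "\<alpha> \<in> hom G G" "\<alpha> \<in> auto G" using a by (auto simp: AutoGroup_carrier auto_def)
    have \<alpha>_in: "\<alpha> x \<in> carrier G" if "x \<in> carrier G" for x
      using hom_in_carrier[OF \<alpha>(1) that] .
    have \<alpha>_inv: "\<alpha> (inv k) = inv (\<alpha> k)"
      using group_hom.hom_inv[of G G \<alpha> k] k \<alpha>(1) by (simp add: group_hom_def group_hom_axioms_def is_group)
    have "compose (carrier G) \<alpha> (\<kappa> k) = compose (carrier G) (\<kappa> (\<alpha> k)) \<alpha>"
      using k \<alpha>_in by (auto simp: fun_eq_iff compose_def \<kappa>_def hom_mult[OF \<alpha>(1)] \<alpha>_inv)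
    then have "\<alpha> \<otimes>\<^bsub>AutoGroup G\<^esub> \<beta> = \<kappa> (\<alpha> k) \<otimes>\<^bsub>AutoGroup G\<^esub> \<alpha>"
      using \<alpha> k \<alpha>_in by (simp add: AutoGroup_mult \<kappa>_auto \<beta>)
    then have "\<alpha> \<otimes>\<^bsub>AutoGroup G\<^esub> \<beta> \<otimes>\<^bsub>AutoGroup G\<^esub> inv\<^bsub>AutoGroup G\<^esub> \<alpha> = \<kappa> (\<alpha> k)"
      using a k \<alpha>_in[OF k] by (simp add: Au.m_assoc)
    then show "\<alpha> \<otimes>\<^bsub>AutoGroup G\<^esub> \<beta> \<otimes>\<^bsub>AutoGroup G\<^esub> inv\<^bsub>AutoGroup G\<^esub> \<alpha> \<in> Inn G"
      using k \<alpha>_in by (auto simp: Inn)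
  qed
qed

context
  fixes K :: "('k, 'l) monoid_scheme" and i :: "'k \<Rightarrow> 'g" and G :: "('g, 'm) monoid_scheme"
    and p :: "'g \<Rightarrow> 'q" and Q :: "('q, 'n) monoid_scheme"
  assumes ext: "group_extension K i G p Q"
begin

interpretation i: group_hom K G i using ext by (simp add: group_extension_def)
interpretation p: group_hom G Q p using ext by (simp add: group_extension_def)

lemma conj_auto_lift:
  assumes g: "g \<in> carrier G" and x: "x \<in> carrier K"
  shows "conj_auto K i G g x \<in> carrier K"
    and "i (conj_auto K i G g x) = g \<otimes>\<^bsub>G\<^esub> i x \<otimes>\<^bsub>G\<^esub> inv\<^bsub>G\<^esub> g"
proof -
  have ker: "kernel G Q p = i ` carrier K" using ext by (simp add: group_extension_def)
  have "i x \<in> kernel G Q p" using x ker by auto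
  then have "g \<otimes>\<^bsub>G\<^esub> i x \<otimes>\<^bsub>G\<^esub> inv\<^bsub>G\<^esub> g \<in> kernel G Q p"
    using p.normal_kernel g by (simp add: i.H.normal_inv_iff)
  then have "g \<otimes>\<^bsub>G\<^esub> i x \<otimes>\<^bsub>G\<^esub> inv\<^bsub>G\<^esub> g \<in> i ` carrier K" by (simp add: ker)
  then show "conj_auto K i G g x \<in> carrier K"
    and "i (conj_auto K i G g x) = g \<otimes>\<^bsub>G\<^esub> i x \<otimes>\<^bsub>G\<^esub> inv\<^bsub>G\<^esub> g"
    using x by (simp_all add: conj_auto_def inv_into_into f_inv_into_f)
qed

lemma conj_auto_eqI:
  assumes "g \<in> carrier G" "x \<in> carrier K" "y \<in> carrier K"
    and "i y = g \<otimes>\<^bsub>G\<^esub> i x \<otimes>\<^bsub>G\<^esub> inv\<^bsub>G\<^esub> g"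
  shows "conj_auto K i G g x = y"
proof -
  have "inj_on i (carrier K)" using ext by (simp add: group_extension_def)
  then show ?thesis using assms conj_auto_lift[of g x] by (metis inj_onD)
qed

lemma conj_auto_compose:
  assumes "g \<in> carrier G" "h \<in> carrier G"
  shows "conj_auto K i G (g \<otimes>\<^bsub>G\<^esub> h) = compose (carrier K) (conj_auto K i G g) (conj_auto K i G h)"
proof
  fix x
  show "conj_auto K i G (g \<otimes>\<^bsub>G\<^esub> h) x = compose (carrier K) (conj_auto K i G g) (conj_auto K i G h) x"
  proof (cases "x \<in> carrier K")
    case True
    then show ?thesis using assms
      by (auto simp: compose_def conj_auto_lift i.H.inv_mult_group i.H.m_assoc intro!: conj_auto_eqI)
  qed (simp add: conj_auto_def compose_def)
qed

lemma conj_auto_one: "conj_auto K i G \<one>\<^bsub>G\<^esub> = (\<lambda>x \<in> carrier K. x)"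
proof
  fix x
  show "conj_auto K i G \<one>\<^bsub>G\<^esub> x = (\<lambda>x \<in> carrier K. x) x"
    by (cases "x \<in> carrier K") (auto intro: conj_auto_eqI, simp add: conj_auto_def)
qed

lemma conj_auto_in_auto:
  assumes g: "g \<in> carrier G"
  shows "conj_auto K i G g \<in> auto K"
proof -
  have inverse: "conj_auto K i G h (conj_auto K i G k x) = x"
    if "h \<in> carrier G" "k \<in> carrier G" "h \<otimes>\<^bsub>G\<^esub> k = \<one>\<^bsub>G\<^esub>" "x \<in> carrier K" for h k x
    using fun_cong[OF conj_auto_compose[OF that(1,2)], of x] that
    by (simp add: conj_auto_one compose_def)
  have "bij_betw (conj_auto K i G g) (carrier K) (carrier K)"
    using g inverse[of g "inv\<^bsub>G\<^esub> g"] inverse[of "inv\<^bsub>G\<^esub> g" g]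
    by (intro bij_betwI[where g = "conj_auto K i G (inv\<^bsub>G\<^esub> g)"]) (auto simp: conj_auto_lift)
  moreover have "conj_auto K i G g \<in> hom K K"
  proof (rule homI)
    fix x y assume xy: "x \<in> carrier K" "y \<in> carrier K"
    show "conj_auto K i G g (x \<otimes>\<^bsub>K\<^esub> y) = conj_auto K i G g x \<otimes>\<^bsub>K\<^esub> conj_auto K i G g y"
      using xy g by (intro conj_auto_eqI) (simp_all add: conj_auto_lift i.H.inner_mult)
  qed (simp add: conj_auto_lift g)
  ultimately show ?thesis by (simp add: auto_def Bij_def conj_auto_def)
qed

lemma conj_auto_Inn: "k \<in> carrier K \<Longrightarrow> conj_auto K i G (i k) \<in> Inn K"
proof -
  assume k: "k \<in> carrier K"
  have "conj_auto K i G (i k) = (\<lambda>x \<in> carrier K. k \<otimes>\<^bsub>K\<^esub> x \<otimes>\<^bsub>K\<^esub> inv\<^bsub>K\<^esub> k)"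
  proof
    fix x
    show "conj_auto K i G (i k) x = (\<lambda>x \<in> carrier K. k \<otimes>\<^bsub>K\<^esub> x \<otimes>\<^bsub>K\<^esub> inv\<^bsub>K\<^esub> k) x"
      using k by (cases "x \<in> carrier K") (auto intro: conj_auto_eqI, simp add: conj_auto_def)
  qed
  with k show ?thesis by (auto simp: Inn_def)
qed

theorem coupling_eq:
  assumes g: "g \<in> carrier G"
  shows "coupling K i G p (p g) = Inn K #>\<^bsub>AutoGroup K\<^esub> conj_auto K i G g"
proof -
  interpret Au: group "AutoGroup K" by (rule i.G.AutoGroup)
  interpret Inn: normal "Inn K" "AutoGroup K" by (rule i.G.Inn_normal)
  define h where "h = inv_into (carrier G) p (p g)"
  have h: "h \<in> carrier G" "p h = p g"
    using g by (auto simp: h_def inv_into_into f_inv_into_f)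
  have "h \<otimes>\<^bsub>G\<^esub> inv\<^bsub>G\<^esub> g \<in> kernel G Q p"
    using g h by (simp add: kernel_def)
  then obtain k where k: "k \<in> carrier K" "h \<otimes>\<^bsub>G\<^esub> inv\<^bsub>G\<^esub> g = i k"
    using ext by (auto simp: group_extension_def)
  have "h = i k \<otimes>\<^bsub>G\<^esub> g"
    using g h k(1) by (simp add: i.H.m_assoc flip: k(2))
  then have "conj_auto K i G h = conj_auto K i G (i k) \<otimes>\<^bsub>AutoGroup K\<^esub> conj_auto K i G g"
    using g k by (simp add: conj_auto_compose AutoGroup_mult conj_auto_in_auto)
  then have "conj_auto K i G h \<in> Inn K #>\<^bsub>AutoGroup K\<^esub> conj_auto K i G g"
    using conj_auto_Inn[OF k(1)] by (auto simp: r_coset_def)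
  then show ?thesis
    unfolding coupling_def h_def[symmetric]
    using g conj_auto_in_auto Inn.subgroup_axioms
    by (metis Au.repr_independence AutoGroup_carrier)
qed

theorem coupling_hom: "coupling K i G p \<in> hom Q (Out K)"
proof -
  interpret Au: group "AutoGroup K" by (rule i.G.AutoGroup)
  interpret Inn: normal "Inn K" "AutoGroup K" by (rule i.G.Inn_normal)
  have surj: "carrier Q = p ` carrier G" using ext by (simp add: group_extension_def)
  have c: "conj_auto K i G g \<in> carrier (AutoGroup K)" if "g \<in> carrier G" for g
    using that by (simp add: AutoGroup_carrier conj_auto_in_auto)
  show ?thesis
  proof (rule homI)
    fix q assume "q \<in> carrier Q"
    then show "coupling K i G p q \<in> carrier (Out K)"
      using c by (auto simp: surj coupling_eq Out_def carrier_FactGroup)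
  next
    fix q r assume "q \<in> carrier Q" "r \<in> carrier Q"
    then obtain g h where gh: "g \<in> carrier G" "q = p g" "h \<in> carrier G" "r = p h"
      by (auto simp: surj)
    have "coupling K i G p (q \<otimes>\<^bsub>Q\<^esub> r) = coupling K i G p (p (g \<otimes>\<^bsub>G\<^esub> h))" using gh by simp
    also have "\<dots> = Inn K #>\<^bsub>AutoGroup K\<^esub> (conj_auto K i G g \<otimes>\<^bsub>AutoGroup K\<^esub> conj_auto K i G h)"
      using gh by (simp add: coupling_eq conj_auto_compose AutoGroup_mult conj_auto_in_auto del: p.hom_mult)
    finally show "coupling K i G p (q \<otimes>\<^bsub>Q\<^esub> r) = coupling K i G p q \<otimes>\<^bsub>Out K\<^esub> coupling K i G p r"
      using gh c by (simp add: coupling_eq Out_def Inn.rcos_sum)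
  qed
qed

end

end

theory Submission
  imports Defs
begin

text \<open>
  An element outside \<open>C\<close> that is a reduced word with both ends in the same factor has conjugates of
  unbounded length. If one factor, say \<open>A\<close>, has more than two cosets of \<open>C\<close>, a reduced word starting
  in \<open>A\<close> and ending in \<open>B\<close> is conjugate by some element of \<open>A\<close> to a word with both ends in \<open>A\<close>. So in
  a non-degenerate amalgam every finite conjugacy class lies in \<open>C\<close>, hence in the largest normal
  subgroup within \<open>C\<close>.

  In the degenerate case let \<open>g\<close> have a finite conjugacy class. Each commutator \<open>[g, c]\<close> with \<open>c \<in> C\<close>
  also has one and lies in \<open>C\<close>, so \<open>FC\<^sub>G(C) = 1\<close> forces \<open>g\<close> to centralize \<open>C\<close>; an injective coupling
  then puts \<open>g\<close> into \<open>C\<close>. Conversely, the kernel of a non-injective coupling is a non-trivial normal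
  subgroup of a group generated by two involutions and therefore contains some \<open>d \<noteq> 1\<close> generating a
  cyclic subgroup of finite index. A suitable lift of \<open>d\<close> centralizes \<open>C\<close> and itself, so its
  centralizer has finite index.
\<close>

section \<open>Conjugacy classes\<close>

context group
begin

lemma conj_class_one: "conj_class G \<one> = {\<one>}"
  by (auto simp: conj_class_def intro: exI[of _ \<one>])

lemma conj_class_conj:
  assumes "g \<in> carrier G" "x \<in> carrier G"
  shows "conj_class G (g \<otimes> x \<otimes> inv g) = conj_class G x"
proof -
  have sub: "conj_class G (h \<otimes> y \<otimes> inv h) \<subseteq> conj_class G y"
    if "h \<in> carrier G" "y \<in> carrier G" for h y
  proof
    fix z assume "z \<in> conj_class G (h \<otimes> y \<otimes> inv h)"
    then obtain k where k: "k \<in> carrier G" "z = k \<otimes> (h \<otimes> y \<otimes> inv h) \<otimes> inv k"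
      by (auto simp: conj_class_def)
    have "z = (k \<otimes> h) \<otimes> y \<otimes> inv (k \<otimes> h)"
      using k that by (simp add: m_assoc inv_mult_group)
    moreover have "k \<otimes> h \<in> carrier G" using k that by simp
    ultimately show "z \<in> conj_class G y" unfolding conj_class_def by blast
  qed
  have "inv g \<otimes> (g \<otimes> x \<otimes> inv g) \<otimes> inv (inv g) = x"
    using assms by (simp add: m_assoc inv_solve_left')
  with sub[of g x] sub[of "inv g" "g \<otimes> x \<otimes> inv g"] assms show ?thesis by auto
qed

text \<open>Together with \<open>finite_conj_class_mult\<close> and \<open>conj_class_conj\<close>
  this passes finiteness of the class of \<open>g\<close> on to every commutator
  \<open>[g, c]\<close>, which is \<open>g\<close> times a conjugate of its inverse.\<close>

lemma finite_conj_class_inv: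
  assumes "x \<in> carrier G" "finite (conj_class G x)"
  shows "finite (conj_class G (inv x))"
proof (rule finite_subset)
  show "conj_class G (inv x) \<subseteq> m_inv G ` conj_class G x"
  proof
    fix z assume "z \<in> conj_class G (inv x)"
    then obtain g where g: "g \<in> carrier G" "z = g \<otimes> inv x \<otimes> inv g"
      by (auto simp: conj_class_def)
    then have "z = inv (g \<otimes> x \<otimes> inv g)" using assms by (simp add: inv_mult_group m_assoc)
    with g(1) show "z \<in> m_inv G ` conj_class G x" unfolding conj_class_def by blast
  qed
qed (use assms in simp)

lemma finite_conj_class_mult:
  assumes "x \<in> carrier G" "y \<in> carrier G" "finite (conj_class G x)" "finite (conj_class G y)"
  shows "finite (conj_class G (x \<otimes> y))"
proof (rule finite_subset)
  show "conj_class G (x \<otimes> y) \<subseteq> (\<lambda>(u, v). u \<otimes> v) ` (conj_class G x \<times> conj_class G y)"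
    using assms inner_mult by (fastforce simp: conj_class_def)
qed (use assms in simp)

end


section \<open>Groups generated by two involutions\<close>

text \<open>Moving \<open>a\<close> past one factor at a time settles natural exponents; for a
  negative exponent, cancel the two powers on either side of the identity for the opposite
  exponent.\<close>

lemma (in group) int_pow_swap:
  assumes "a \<in> carrier G" "x \<in> carrier G" "y \<in> carrier G" "a \<otimes> x = y \<otimes> a"
  shows "a \<otimes> x [^] (i::int) = y [^] i \<otimes> a"
proof -
  have nat: "a \<otimes> x [^] n = y [^] n \<otimes> a" for n :: nat
  proof (induction n)
    case (Suc n)
    have "a \<otimes> x [^] Suc n = y [^] n \<otimes> a \<otimes> x" using assms Suc by (simp flip: m_assoc)
    also have "\<dots> = y [^] Suc n \<otimes> a" using assms by (simp add: m_assoc)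
    finally show ?case .
  qed (use assms in simp)
  show ?thesis
  proof (cases i)
    case (nonneg n)
    with nat[of n] show ?thesis by (simp add: int_pow_int)
  next
    case (neg n)
    have "inv (y [^] Suc n) \<otimes> (a \<otimes> x [^] Suc n) \<otimes> inv (x [^] Suc n)
        = inv (y [^] Suc n) \<otimes> (y [^] Suc n \<otimes> a) \<otimes> inv (x [^] Suc n)"
      by (simp only: nat)
    then have "inv (y [^] Suc n) \<otimes> a = a \<otimes> inv (x [^] Suc n)"
      using assms by (simp add: m_assoc inv_solve_left' del: nat_pow_Suc)
    with neg assms show ?thesis by (simp add: int_pow_neg int_pow_int del: nat_pow_Suc of_nat_Suc)
  qed
qed

text \<open>Quotients of the infinite dihedral group, finite ones included. Generation is stated as
  an induction principle; left multiplication by the generators suffices because each is its own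
  inverse.\<close>

locale two_involutions = group D for D (structure) +
  fixes \<alpha> \<beta>
  assumes \<alpha>: "\<alpha> \<in> carrier D" "\<alpha> \<otimes> \<alpha> = \<one>" and \<beta>: "\<beta> \<in> carrier D" "\<beta> \<otimes> \<beta> = \<one>"
    and generated: "\<And>S. \<one> \<in> S \<Longrightarrow> (\<And>x. x \<in> S \<Longrightarrow> x \<in> carrier D \<Longrightarrow> \<alpha> \<otimes> x \<in> S)
      \<Longrightarrow> (\<And>x. x \<in> S \<Longrightarrow> x \<in> carrier D \<Longrightarrow> \<beta> \<otimes> x \<in> S) \<Longrightarrow> carrier D \<subseteq> S"
begin

text \<open>In the dihedral picture \<open>\<alpha>\<close> and \<open>\<beta>\<close> are
  reflections and \<open>\<tau>\<close> is a rotation, of finite or infinite order.\<close>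

definition "\<tau> = \<alpha> \<otimes> \<beta>"

lemma \<tau> [simp]: "\<tau> \<in> carrier D"
  using \<alpha> \<beta> by (simp add: \<tau>_def)

lemma inv_\<tau>: "inv \<tau> = \<beta> \<otimes> \<alpha>"
  using \<alpha> \<beta> by (metis \<tau>_def inv_mult_group inv_equality)

lemma \<alpha>_\<tau>: "\<alpha> \<otimes> \<tau> [^] (i::int) = \<tau> [^] (-i) \<otimes> \<alpha>"
proof -
  have "\<alpha> \<otimes> \<tau> [^] i = inv \<tau> [^] i \<otimes> \<alpha>"
  proof (rule int_pow_swap)
    show "\<alpha> \<otimes> \<tau> = inv \<tau> \<otimes> \<alpha>"
      using \<alpha> \<beta> by (simp add: inv_\<tau> m_assoc) (simp add: \<tau>_def flip: m_assoc)
  qed (use \<alpha> in auto)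
  then show ?thesis by (simp add: int_pow_inv int_pow_neg)
qed

text \<open>The rotations \<open>\<tau> [^] i\<close> and the reflections
  \<open>\<alpha> \<otimes> \<tau> [^] i\<close> together contain the identity and are stable under
  left multiplication by \<open>\<alpha>\<close> and by
  \<open>\<beta> = \<alpha> \<otimes> \<tau>\<close>.\<close>

lemma normal_form: "x \<in> carrier D \<Longrightarrow> \<exists>e\<in>{\<one>, \<alpha>}. \<exists>i::int. x = e \<otimes> \<tau> [^] i"
proof -
  let ?S = "{e \<otimes> \<tau> [^] i | e i. e \<in> {\<one>, \<alpha>} \<and> i \<in> (UNIV :: int set)}"
  have in_S: "\<tau> [^] i \<in> ?S" "\<alpha> \<otimes> \<tau> [^] i \<in> ?S" for i :: int
    by (auto intro!: exI[of _ i] intro: exI[of _ \<one>] exI[of _ \<alpha>])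
  have \<beta>_\<alpha>\<tau>: "\<beta> = \<alpha> \<otimes> \<tau>" using \<alpha> \<beta> by (simp add: \<tau>_def flip: m_assoc)
  have "carrier D \<subseteq> ?S"
  proof (rule generated)
    show "\<one> \<in> ?S" using in_S(1)[of 0] by simp
  next
    fix x assume "x \<in> ?S"
    then have "\<exists>i::int. x = \<tau> [^] i \<or> x = \<alpha> \<otimes> \<tau> [^] i" by auto
    then obtain i :: int where "x = \<tau> [^] i \<or> x = \<alpha> \<otimes> \<tau> [^] i" by blast
    moreover have "\<alpha> \<otimes> (\<alpha> \<otimes> \<tau> [^] i) = \<tau> [^] i" using \<alpha> by (simp flip: m_assoc)
    ultimately show "\<alpha> \<otimes> x \<in> ?S" using in_S by auto
  next
    fix x assume "x \<in> ?S"
    then have "\<exists>i::int. x = \<tau> [^] i \<or> x = \<alpha> \<otimes> \<tau> [^] i" by auto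
    then obtain i :: int where "x = \<tau> [^] i \<or> x = \<alpha> \<otimes> \<tau> [^] i" by blast
    moreover have "\<beta> \<otimes> \<tau> [^] i = \<alpha> \<otimes> \<tau> [^] (1 + i)"
      using \<alpha> by (subst \<beta>_\<alpha>\<tau>) (simp add: m_assoc int_pow_mult)
    moreover have "\<beta> \<otimes> (\<alpha> \<otimes> \<tau> [^] i) = \<tau> [^] (-1 + i)"
    proof -
      have "\<beta> \<otimes> (\<alpha> \<otimes> \<tau> [^] i) = inv \<tau> \<otimes> \<tau> [^] i"
        using \<alpha>(1) \<beta>(1) by (simp add: inv_\<tau> m_assoc)
      also have "inv \<tau> = \<tau> [^] (-1 :: int)" by (simp add: int_pow_neg)
      finally show ?thesis by (simp only: int_pow_mult \<tau>)
    qed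
    ultimately show "\<beta> \<otimes> x \<in> ?S" using in_S(1)[of "-1 + i"] in_S(2)[of "1 + i"] by (elim disjE) simp_all
  qed
  then show "x \<in> carrier D \<Longrightarrow> \<exists>e\<in>{\<one>, \<alpha>}. \<exists>i::int. x = e \<otimes> \<tau> [^] i" by blast
qed

text \<open>If \<open>N\<close> contains a non-trivial power of \<open>\<tau>\<close>, that power
  serves as \<open>d\<close>, and division with remainder yields the cosets. Otherwise
  \<open>N\<close> contains a reflection, which forces \<open>\<tau>\<close> to have order at most
  2; then \<open>D\<close> is finite and any non-trivial \<open>d\<close> in \<open>N\<close>
  works.\<close>

lemma normal_subgroup_cofinite_cyclic:
  assumes N: "N \<lhd> D" "N \<noteq> {\<one>}"
  obtains d F where "d \<in> N" "d \<noteq> \<one>" "finite F" "F \<subseteq> carrier D"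
    "\<And>x. x \<in> carrier D \<Longrightarrow> \<exists>f\<in>F. \<exists>i::int. x = f \<otimes> d [^] i"
proof -
  interpret N: normal N D by fact
  \<comment> \<open>The interval is symmetric because \<open>i mod k\<close> takes the sign of
    \<open>k\<close>.\<close>
  define F where "F k = (\<lambda>(e, r). e \<otimes> \<tau> [^] r) ` ({\<one>, \<alpha>} \<times> {-\<bar>k\<bar>..\<bar>k\<bar>})" for k :: int
  have F: "finite (F k)" "F k \<subseteq> carrier D" for k
    using \<alpha> by (auto simp: F_def)
  have split: "\<exists>f\<in>F k. \<exists>i::int. x = f \<otimes> (\<tau> [^] k) [^] i" if x: "x \<in> carrier D" and k: "k \<noteq> 0" for x k
  proof -
    obtain e and i :: int where e: "e \<in> {\<one>, \<alpha>}" "x = e \<otimes> \<tau> [^] i"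
      using normal_form[OF x] by blast
    have "\<tau> [^] i = \<tau> [^] (i mod k) \<otimes> (\<tau> [^] k) [^] (i div k)"
      by (simp add: int_pow_pow flip: int_pow_mult)
    then have "x = (e \<otimes> \<tau> [^] (i mod k)) \<otimes> (\<tau> [^] k) [^] (i div k)"
      using e \<alpha> by (auto simp: m_assoc)
    moreover have "i mod k \<in> {-\<bar>k\<bar>..\<bar>k\<bar>}"
      using k abs_mod_less[of k i] by auto
    ultimately show ?thesis using e(1)
      by (intro bexI[of _ "e \<otimes> \<tau> [^] (i mod k)"] exI[of _ "i div k"]) (auto simp: F_def)
  qed
  obtain d where d: "d \<in> N" "d \<noteq> \<one>" using N(2) N.one_closed by blast
  show thesis
  proof (cases "\<exists>k::int. \<tau> [^] k \<in> N \<and> \<tau> [^] k \<noteq> \<one>")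
    case True
    then obtain k :: int where k: "\<tau> [^] k \<in> N" "\<tau> [^] k \<noteq> \<one>" by blast
    then have "k \<noteq> 0" by (metis int_pow_0)
    with k F split show thesis by (intro that[of "\<tau> [^] k" "F k"]) auto
  next
    case False
    obtain k :: int where k: "d = \<alpha> \<otimes> \<tau> [^] k"
      using normal_form[of d] d False by auto
    \<comment> \<open>The reflection \<open>d\<close> times its conjugate by \<open>\<tau>\<close>
      is a rotation in \<open>N\<close>, namely \<open>\<tau> [^] (-2)\<close>.\<close>
    have "d \<otimes> (\<tau> \<otimes> d \<otimes> inv \<tau>) \<in> N"
      using d(1) N.inv_op_closed2[of \<tau> d] by simp
    also have "d \<otimes> (\<tau> \<otimes> d \<otimes> inv \<tau>) = \<alpha> \<otimes> (\<tau> [^] k \<otimes> \<tau> [^] (1::int)) \<otimes> \<alpha> \<otimes> (\<tau> [^] k \<otimes> \<tau> [^] (-1::int))"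
      using \<alpha> by (simp add: k m_assoc int_pow_neg)
    also have "\<dots> = \<tau> [^] (- (k + 1)) \<otimes> \<alpha> \<otimes> \<alpha> \<otimes> \<tau> [^] (k + - 1)"
      by (simp only: \<tau> \<alpha>_\<tau> flip: int_pow_mult[of \<tau>])
    also have "\<dots> = \<tau> [^] (- (k + 1)) \<otimes> (\<alpha> \<otimes> \<alpha>) \<otimes> \<tau> [^] (k + - 1)"
      using \<alpha>(1) by (simp add: m_assoc)
    also have "\<dots> = \<tau> [^] (- (k + 1) + (k + - 1))"
      using \<alpha>(2) by (simp only: r_one int_pow_closed \<tau> flip: int_pow_mult[of \<tau>])
    also have "- (k + 1) + (k + - 1) = -2" by simp
    finally have "\<tau> [^] (-2 :: int) = \<one>" using False by blast
    \<comment> \<open>The powers of \<open>\<tau> [^] (-2)\<close> are trivial, so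
      \<open>F (-2)\<close> is already all of \<open>D\<close> and the exponent 0 does.\<close>
    then have "\<exists>f\<in>F (-2). x = f \<otimes> d [^] (0::int)" if x: "x \<in> carrier D" for x
      using split[OF x, of "-2"] by (auto simp: int_pow_one)
    with d F show thesis by (intro that[of d "F (-2)"]) blast+
  qed
qed

end

section \<open>Generation of free products with identifications by their factors\<close>

text \<open>An element is the class of a word, hence arises from the identity by prepending letters.
  Inverses of letters are letters, so left multiplication by the two factors reaches
  everything.\<close>

lemma fpi_carrier_subset:
  fixes A :: "('a, 'm) monoid_scheme" and B :: "('b, 'n) monoid_scheme" and R :: "('a \<times> 'b) set"
  defines "P \<equiv> free_product_ident A B R"
  assumes A: "group A" and B: "group B" and one: "\<one>\<^bsub>P\<^esub> \<in> S"
    and inl: "\<And>a g. a \<in> carrier A \<Longrightarrow> g \<in> S \<Longrightarrow> g \<in> carrier P \<Longrightarrow> fpi_inl A B R a \<otimes>\<^bsub>P\<^esub> g \<in> S"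
    and inr: "\<And>b g. b \<in> carrier B \<Longrightarrow> g \<in> S \<Longrightarrow> g \<in> carrier P \<Longrightarrow> fpi_inr A B R b \<otimes>\<^bsub>P\<^esub> g \<in> S"
  shows "carrier P \<subseteq> S"
proof
  fix g assume "g \<in> carrier P"
  then obtain w where w: "w \<in> lists (letters A B)" "g = word_cong A B R `` {w}"
    by (auto simp: P_def fpi_carrier[OF A B])
  have "word_cong A B R `` {w} \<in> S" using w(1)
  proof (induction w)
    case Nil
    then show ?case using one by (simp add: P_def fpi_one[OF A B])
  next
    case (Cons l w)
    then have "word_cong A B R `` {l # w} = word_cong A B R `` {[l]} \<otimes>\<^bsub>P\<^esub> word_cong A B R `` {w}"
      by (simp add: P_def fpi_mult[OF A B])
    moreover have "word_cong A B R `` {w} \<in> carrier P"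
      using Cons by (auto simp: P_def fpi_carrier[OF A B])
    ultimately show ?case
      using Cons inl inr by (auto simp: letters_def fpi_inl_def fpi_inr_def)
  qed
  with w show "g \<in> S" by simp
qed

lemma two_involutions_free_product:
  "two_involutions (free_product (integer_mod_group 2) (integer_mod_group 2))
    (fpi_inl (integer_mod_group 2) (integer_mod_group 2) {} 1)
    (fpi_inr (integer_mod_group 2) (integer_mod_group 2) {} 1)"
proof -
  let ?Z = "integer_mod_group 2" and ?D = "free_product (integer_mod_group 2) (integer_mod_group 2)"
  let ?l = "fpi_inl ?Z ?Z {}" and ?r = "fpi_inr ?Z ?Z {}"
  note Z = group_integer_mod_group[of 2]
  interpret D: group ?D unfolding free_product_def by (rule group_free_product_ident[OF Z Z])
  have "?l \<in> hom ?Z ?D" "?r \<in> hom ?Z ?D"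
    unfolding free_product_def by (rule fpi_inl_hom[OF Z Z], rule fpi_inr_hom[OF Z Z])
  then interpret l: group_hom ?Z ?D ?l + r: group_hom ?Z ?D ?r
    by (simp_all add: group_hom_def group_hom_axioms_def Z D.group_axioms)
  have Z2: "n \<in> carrier ?Z \<longleftrightarrow> n = 0 \<or> n = 1" "\<one>\<^bsub>?Z\<^esub> = 0" "1 \<otimes>\<^bsub>?Z\<^esub> 1 = 0" for n
    by (auto simp: integer_mod_group_def)
  show ?thesis
  proof unfold_locales
    show "?l 1 \<in> carrier ?D" "?r 1 \<in> carrier ?D" using Z2 by auto
    show "?l 1 \<otimes>\<^bsub>?D\<^esub> ?l 1 = \<one>\<^bsub>?D\<^esub>" "?r 1 \<otimes>\<^bsub>?D\<^esub> ?r 1 = \<one>\<^bsub>?D\<^esub>"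
      using l.hom_mult[of 1 1] r.hom_mult[of 1 1] l.hom_one r.hom_one by (simp_all add: Z2)
  next
    fix S assume S: "\<one>\<^bsub>?D\<^esub> \<in> S"
      "\<And>x. x \<in> S \<Longrightarrow> x \<in> carrier ?D \<Longrightarrow> ?l 1 \<otimes>\<^bsub>?D\<^esub> x \<in> S"
      "\<And>x. x \<in> S \<Longrightarrow> x \<in> carrier ?D \<Longrightarrow> ?r 1 \<otimes>\<^bsub>?D\<^esub> x \<in> S"
    have "?l 0 = \<one>\<^bsub>?D\<^esub>" "?r 0 = \<one>\<^bsub>?D\<^esub>" using l.hom_one r.hom_one by (simp_all add: Z2)
    with S have "?l n \<otimes>\<^bsub>?D\<^esub> x \<in> S" "?r n \<otimes>\<^bsub>?D\<^esub> x \<in> S"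
      if "n \<in> carrier ?Z" "x \<in> S" "x \<in> carrier ?D" for n x
      using that by (auto simp: Z2)
    with S(1) show "carrier ?D \<subseteq> S"
      unfolding free_product_def by (intro fpi_carrier_subset[OF Z Z])
  qed
qed


section \<open>Extensions with injective and non-injective coupling\<close>

context
  fixes K :: "('k, 'l) monoid_scheme" and i :: "'k \<Rightarrow> 'g" and G :: "('g, 'm) monoid_scheme"
    and p :: "'g \<Rightarrow> 'q" and Q :: "('q, 'n) monoid_scheme"
  assumes ext: "group_extension K i G p Q"
begin

interpretation i: group_hom K G i using ext by (simp add: group_extension_def)
interpretation p: group_hom G Q p using ext by (simp add: group_extension_def)
interpretation Au: group "AutoGroup K" by (rule i.G.AutoGroup)
interpretation Inn: normal "Inn K" "AutoGroup K" by (rule i.G.Inn_normal)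

lemma group_Out: "group (Out K)"
  unfolding Out_def by (rule Inn.factorgroup_is_group)

text \<open>Pulls membership in the kernel of the coupling, a statement about cosets of
  automorphisms, back along \<open>i\<close> to an identity between conjugations inside
  \<open>G\<close>.\<close>

lemma coupling_trivial_iff:
  assumes g: "g \<in> carrier G"
  shows "coupling K i G p (p g) = \<one>\<^bsub>Out K\<^esub> \<longleftrightarrow>
    (\<exists>k\<in>carrier K. \<forall>x\<in>carrier K. g \<otimes>\<^bsub>G\<^esub> i x \<otimes>\<^bsub>G\<^esub> inv\<^bsub>G\<^esub> g = i k \<otimes>\<^bsub>G\<^esub> i x \<otimes>\<^bsub>G\<^esub> inv\<^bsub>G\<^esub> i k)"
    (is "_ \<longleftrightarrow> ?R")
proof -
  have au: "conj_auto K i G g \<in> carrier (AutoGroup K)"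
    using conj_auto_in_auto[OF ext g] by (simp add: AutoGroup_carrier)
  have "coupling K i G p (p g) = \<one>\<^bsub>Out K\<^esub> \<longleftrightarrow> Inn K #>\<^bsub>AutoGroup K\<^esub> conj_auto K i G g = Inn K"
    by (simp add: coupling_eq[OF ext g] Out_def)
  also have "\<dots> \<longleftrightarrow> conj_auto K i G g \<in> Inn K"
    using au Au.coset_join1[of "Inn K"] Au.coset_join2[of _ "Inn K"] Inn.subgroup_axioms Inn.subset by blast
  also have "\<dots> \<longleftrightarrow> ?R"
  proof
    assume "conj_auto K i G g \<in> Inn K"
    then obtain k where k: "k \<in> carrier K"
      "conj_auto K i G g = (\<lambda>x \<in> carrier K. k \<otimes>\<^bsub>K\<^esub> x \<otimes>\<^bsub>K\<^esub> inv\<^bsub>K\<^esub> k)"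
      by (auto simp: Inn_def)
    have "g \<otimes>\<^bsub>G\<^esub> i x \<otimes>\<^bsub>G\<^esub> inv\<^bsub>G\<^esub> g = i k \<otimes>\<^bsub>G\<^esub> i x \<otimes>\<^bsub>G\<^esub> inv\<^bsub>G\<^esub> i k"
      if x: "x \<in> carrier K" for x
      using conj_auto_lift(2)[OF ext g x] k x by simp
    with k show ?R by blast
  next
    assume ?R
    then obtain k where k: "k \<in> carrier K"
      "\<And>x. x \<in> carrier K \<Longrightarrow> g \<otimes>\<^bsub>G\<^esub> i x \<otimes>\<^bsub>G\<^esub> inv\<^bsub>G\<^esub> g = i k \<otimes>\<^bsub>G\<^esub> i x \<otimes>\<^bsub>G\<^esub> inv\<^bsub>G\<^esub> i k"
      by blast
    have "conj_auto K i G g = (\<lambda>x \<in> carrier K. k \<otimes>\<^bsub>K\<^esub> x \<otimes>\<^bsub>K\<^esub> inv\<^bsub>K\<^esub> k)"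
    proof
      fix x
      show "conj_auto K i G g x = (\<lambda>x \<in> carrier K. k \<otimes>\<^bsub>K\<^esub> x \<otimes>\<^bsub>K\<^esub> inv\<^bsub>K\<^esub> k) x"
        using k g conj_auto_eqI[OF ext g, of x "k \<otimes>\<^bsub>K\<^esub> x \<otimes>\<^bsub>K\<^esub> inv\<^bsub>K\<^esub> k"]
        by (cases "x \<in> carrier K") (simp, simp add: conj_auto_def)
    qed
    with k(1) show "conj_auto K i G g \<in> Inn K" by (auto simp: Inn_def)
  qed
  finally show ?thesis .
qed

lemma infinite_conj_class_if_coupling_inj:
  assumes FC: "FC G (i ` carrier K) = {\<one>\<^bsub>G\<^esub>}"
    and inj: "inj_on (coupling K i G p) (carrier Q)"
    and g: "g \<in> carrier G" "g \<noteq> \<one>\<^bsub>G\<^esub>"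
  shows "infinite (conj_class G g)"
proof
  assume fin: "finite (conj_class G g)"
  \<comment> \<open>The right-hand side is just \<open>i x\<close>; it is written this way to match
    \<open>coupling_trivial_iff\<close> with the identity of \<open>K\<close> as witness.\<close>
  have "g \<otimes>\<^bsub>G\<^esub> i x \<otimes>\<^bsub>G\<^esub> inv\<^bsub>G\<^esub> g = i \<one>\<^bsub>K\<^esub> \<otimes>\<^bsub>G\<^esub> i x \<otimes>\<^bsub>G\<^esub> inv\<^bsub>G\<^esub> i \<one>\<^bsub>K\<^esub>"
    if x: "x \<in> carrier K" for x
  proof -
    \<comment> \<open>The commutator \<open>[g, i x]\<close> lies in the image of \<open>K\<close>; as the product of \<open>g\<close> with a
      conjugate of \<open>g\<inverse>\<close> it also has a finite conjugacy class.\<close>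
    define z where "z = g \<otimes>\<^bsub>G\<^esub> (i x \<otimes>\<^bsub>G\<^esub> inv\<^bsub>G\<^esub> g \<otimes>\<^bsub>G\<^esub> inv\<^bsub>G\<^esub> i x)"
    have "finite (conj_class G z)" unfolding z_def
      using g x fin i.H.conj_class_conj[of "i x" "inv\<^bsub>G\<^esub> g"] i.H.finite_conj_class_inv[of g]
      by (intro i.H.finite_conj_class_mult[of g]) simp_all
    moreover have "z \<in> i ` carrier K"
    proof -
      have "z = i (conj_auto K i G g x \<otimes>\<^bsub>K\<^esub> inv\<^bsub>K\<^esub> x)"
        using conj_auto_lift[OF ext g(1) x] g x by (simp add: z_def i.H.m_assoc)
      then show ?thesis using conj_auto_lift(1)[OF ext g(1) x] x by blast
    qed
    ultimately have "z = \<one>\<^bsub>G\<^esub>" using FC by (auto simp: FC_def)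
    then have "z \<otimes>\<^bsub>G\<^esub> i x = i x" using x by simp
    then show ?thesis using g x by (simp add: z_def i.H.m_assoc)
  qed
  then have "coupling K i G p (p g) = \<one>\<^bsub>Out K\<^esub>"
    unfolding coupling_trivial_iff[OF g(1)] by (intro bexI[of _ "\<one>\<^bsub>K\<^esub>"]) auto
  also have "\<dots> = coupling K i G p \<one>\<^bsub>Q\<^esub>"
    using hom_one[OF coupling_hom[OF ext]] group_Out by auto
  finally have "p g = \<one>\<^bsub>Q\<^esub>" using inj g(1) by (auto dest: inj_onD)
  then have "g \<in> i ` carrier K"
    using ext g(1) by (auto simp: group_extension_def kernel_def)
  with fin FC g show False by (auto simp: FC_def)
qed

text \<open>With \<open>s\<close> a section of \<open>p\<close>, every \<open>h\<close> is
  \<open>s f\<close> times a power of \<open>z\<close> times an element of the image of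
  \<open>K\<close>. The last two commute with \<open>z\<close>, so the conjugate of \<open>z\<close>
  by \<open>h\<close> depends on \<open>f\<close> only.\<close>

lemma finite_conj_class_if_cofinite_cyclic:
  assumes z: "z \<in> carrier G" "\<And>x. x \<in> carrier K \<Longrightarrow> z \<otimes>\<^bsub>G\<^esub> i x = i x \<otimes>\<^bsub>G\<^esub> z"
    and F: "finite F" "F \<subseteq> carrier Q"
      "\<And>q. q \<in> carrier Q \<Longrightarrow> \<exists>f\<in>F. \<exists>n::int. q = f \<otimes>\<^bsub>Q\<^esub> p z [^]\<^bsub>Q\<^esub> n"
  shows "finite (conj_class G z)"
proof (rule finite_subset)
  define s where "s = inv_into (carrier G) p"
  have s: "s q \<in> carrier G" "p (s q) = q" if "q \<in> carrier Q" for q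
    using that ext by (auto simp: s_def group_extension_def inv_into_into f_inv_into_f)
  show "conj_class G z \<subseteq> (\<lambda>f. s f \<otimes>\<^bsub>G\<^esub> z \<otimes>\<^bsub>G\<^esub> inv\<^bsub>G\<^esub> s f) ` F"
  proof
    fix y assume "y \<in> conj_class G z"
    then obtain h where h: "h \<in> carrier G" "y = h \<otimes>\<^bsub>G\<^esub> z \<otimes>\<^bsub>G\<^esub> inv\<^bsub>G\<^esub> h"
      by (auto simp: conj_class_def)
    obtain f and n :: int where f: "f \<in> F" "p h = f \<otimes>\<^bsub>Q\<^esub> p z [^]\<^bsub>Q\<^esub> n"
      using F(3)[of "p h"] h by auto
    have fQ: "f \<in> carrier Q" using f F by blast
    define u where "u = s f \<otimes>\<^bsub>G\<^esub> z [^]\<^bsub>G\<^esub> n"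
    have u: "u \<in> carrier G" "p u = p h"
      using s[OF fQ] z(1) f by (simp_all add: u_def p.hom_int_pow)
    have "inv\<^bsub>G\<^esub> u \<otimes>\<^bsub>G\<^esub> h \<in> kernel G Q p" using u h by (simp add: kernel_def)
    then obtain k where k: "k \<in> carrier K" "inv\<^bsub>G\<^esub> u \<otimes>\<^bsub>G\<^esub> h = i k"
      using ext by (auto simp: group_extension_def)
    have hu: "h = u \<otimes>\<^bsub>G\<^esub> i k" using u h k(1) by (simp flip: k(2) i.H.m_assoc)
    have zn: "z \<otimes>\<^bsub>G\<^esub> z [^]\<^bsub>G\<^esub> n = z [^]\<^bsub>G\<^esub> n \<otimes>\<^bsub>G\<^esub> z"
      using i.H.int_pow_mult[of z 1 n] i.H.int_pow_mult[of z n 1] z(1) by (simp add: add.commute)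
    have "h \<otimes>\<^bsub>G\<^esub> z = s f \<otimes>\<^bsub>G\<^esub> z [^]\<^bsub>G\<^esub> n \<otimes>\<^bsub>G\<^esub> (z \<otimes>\<^bsub>G\<^esub> i k)"
      using hu u_def z k(1) s(1)[OF fQ] by (simp add: i.H.m_assoc)
    also have "\<dots> = s f \<otimes>\<^bsub>G\<^esub> (z [^]\<^bsub>G\<^esub> n \<otimes>\<^bsub>G\<^esub> z) \<otimes>\<^bsub>G\<^esub> i k"
      using z k(1) s(1)[OF fQ] by (simp add: i.H.m_assoc)
    also have "\<dots> = s f \<otimes>\<^bsub>G\<^esub> z \<otimes>\<^bsub>G\<^esub> (inv\<^bsub>G\<^esub> s f \<otimes>\<^bsub>G\<^esub> s f) \<otimes>\<^bsub>G\<^esub> z [^]\<^bsub>G\<^esub> n \<otimes>\<^bsub>G\<^esub> i k"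
      using z k(1) s(1)[OF fQ] by (simp add: i.H.m_assoc flip: zn)
    also have "\<dots> = s f \<otimes>\<^bsub>G\<^esub> z \<otimes>\<^bsub>G\<^esub> inv\<^bsub>G\<^esub> s f \<otimes>\<^bsub>G\<^esub> h"
      using z(1) k(1) s(1)[OF fQ] by (simp only: hu u_def i.H.m_assoc i.H.m_closed
          i.H.inv_closed i.H.int_pow_closed i.hom_closed)
    finally have "y = s f \<otimes>\<^bsub>G\<^esub> z \<otimes>\<^bsub>G\<^esub> inv\<^bsub>G\<^esub> s f"
      using h z(1) s(1)[OF fQ] by (simp add: i.H.m_assoc)
    with f show "y \<in> (\<lambda>f. s f \<otimes>\<^bsub>G\<^esub> z \<otimes>\<^bsub>G\<^esub> inv\<^bsub>G\<^esub> s f) ` F" by blast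
  qed
qed (use F in simp)

lemma icc_imp_coupling_inj:
  assumes icc: "icc G" and Q: "two_involutions Q \<alpha> \<beta>"
  shows "inj_on (coupling K i G p) (carrier Q)"
proof (rule ccontr)
  assume not_inj: "\<not> inj_on (coupling K i G p) (carrier Q)"
  interpret Q: two_involutions Q \<alpha> \<beta> by (rule Q)
  interpret c: group_hom Q "Out K" "coupling K i G p"
    using coupling_hom[OF ext] group_Out by (simp add: group_hom_def group_hom_axioms_def)
  have "kernel Q (Out K) (coupling K i G p) \<noteq> {\<one>\<^bsub>Q\<^esub>}"
    using not_inj c.inj_iff_trivial_ker by simp
  then obtain d F where d: "d \<in> kernel Q (Out K) (coupling K i G p)" "d \<noteq> \<one>\<^bsub>Q\<^esub>"
    and F: "finite F" "F \<subseteq> carrier Q"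
      "\<And>x. x \<in> carrier Q \<Longrightarrow> \<exists>f\<in>F. \<exists>n::int. x = f \<otimes>\<^bsub>Q\<^esub> d [^]\<^bsub>Q\<^esub> n"
    using Q.normal_subgroup_cofinite_cyclic[OF c.normal_kernel] by metis
  obtain g where g: "g \<in> carrier G" "d = p g"
    using d(1) ext unfolding kernel_def group_extension_def by blast
  then obtain k where k: "k \<in> carrier K"
    and gk: "\<And>x. x \<in> carrier K \<Longrightarrow> g \<otimes>\<^bsub>G\<^esub> i x \<otimes>\<^bsub>G\<^esub> inv\<^bsub>G\<^esub> g = i k \<otimes>\<^bsub>G\<^esub> i x \<otimes>\<^bsub>G\<^esub> inv\<^bsub>G\<^esub> i k"
    using d(1) coupling_trivial_iff[OF g(1)] by (auto simp: kernel_def)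
  \<comment> \<open>\<open>g\<close> and \<open>i k\<close> act alike on the image of
    \<open>K\<close>, so dividing by \<open>i k\<close> gives an element centralizing it; as
    \<open>i k\<close> is in the kernel of \<open>p\<close>, it still maps to
    \<open>d\<close>.\<close>
  define z where "z = inv\<^bsub>G\<^esub> i k \<otimes>\<^bsub>G\<^esub> g"
  have z: "z \<in> carrier G" using g k by (simp add: z_def)
  have "i k \<in> kernel G Q p" using ext k by (auto simp: group_extension_def)
  then have pz: "p z = d" using g k by (simp add: z_def kernel_def)
  have "z \<otimes>\<^bsub>G\<^esub> i x = i x \<otimes>\<^bsub>G\<^esub> z" if x: "x \<in> carrier K" for x
  proof -
    have "z \<otimes>\<^bsub>G\<^esub> i x = inv\<^bsub>G\<^esub> i k \<otimes>\<^bsub>G\<^esub> (g \<otimes>\<^bsub>G\<^esub> i x \<otimes>\<^bsub>G\<^esub> inv\<^bsub>G\<^esub> g) \<otimes>\<^bsub>G\<^esub> g"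
      using g k x by (simp add: z_def i.H.m_assoc del: i.hom_inv)
    also have "\<dots> = i x \<otimes>\<^bsub>G\<^esub> z"
      unfolding gk[OF x] using g k x by (simp add: z_def i.H.m_assoc i.H.inv_solve_left' del: i.hom_inv)
    finally show ?thesis .
  qed
  then have "finite (conj_class G z)"
    using z F by (intro finite_conj_class_if_cofinite_cyclic[of z F]) (auto simp: pz)
  moreover have "z \<noteq> \<one>\<^bsub>G\<^esub>" using pz d(2) by auto
  ultimately show False using icc z by (auto simp: icc_def)
qed

end


section \<open>Reduced words\<close>

text \<open>
  \<open>H True\<close> and \<open>H False\<close> are the two factors, \<open>C\<close> is their common subgroup, and \<open>type_word g\<close> lists
  the factors met in a reduced expression of \<open>g\<close>; it is empty precisely on \<open>C\<close>.
\<close>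

locale amalgam = group G for G (structure) +
  fixes H :: "bool \<Rightarrow> 'a set" and C and type_word :: "'a \<Rightarrow> bool list"
  assumes factor: "subgroup (H s) G" and C: "subgroup C G" and C_less: "C \<subset> H s"
    and generated: "\<And>S. \<one> \<in> S \<Longrightarrow>
      (\<And>s x g. x \<in> H s \<Longrightarrow> g \<in> S \<Longrightarrow> g \<in> carrier G \<Longrightarrow> x \<otimes> g \<in> S) \<Longrightarrow> carrier G \<subseteq> S"
    and type_word_one: "type_word \<one> = []"
    and type_word_C: "c \<in> C \<Longrightarrow> g \<in> carrier G \<Longrightarrow> type_word (c \<otimes> g) = type_word g"
    and type_word_Cons: "x \<in> H s - C \<Longrightarrow> g \<in> carrier G \<Longrightarrow> type_word g = [] \<or> hd (type_word g) \<noteq> s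
      \<Longrightarrow> type_word (x \<otimes> g) = s # type_word g"
begin

lemma factor_carrier: "x \<in> H s \<Longrightarrow> x \<in> carrier G"
  using factor subgroup.mem_carrier by metis

lemma C_factor: "c \<in> C \<Longrightarrow> c \<in> H s"
  using C_less by auto

lemma C_carrier: "c \<in> C \<Longrightarrow> c \<in> carrier G"
  using C subgroup.mem_carrier by metis

lemma C_mult_iff:
  assumes "c \<in> C" "x \<in> carrier G"
  shows "c \<otimes> x \<in> C \<longleftrightarrow> x \<in> C"
proof -
  interpret C: subgroup C G by (rule C)
  have "inv c \<otimes> (c \<otimes> x) = x"
    using assms by (simp add: inv_solve_left')
  then show ?thesis
    using assms(1) by (metis C.m_closed C.m_inv_closed)
qed

lemma factor_mult: "x \<in> H s \<Longrightarrow> y \<in> H s \<Longrightarrow> x \<otimes> y \<in> H s"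
  using factor subgroup.m_closed by metis

lemma factor_inv: "x \<in> H s - C \<Longrightarrow> inv x \<in> H s - C"
  by (metis C DiffD1 DiffD2 DiffI factor factor_carrier inv_inv subgroup.m_inv_closed)

text \<open>Reduced expressions are built from the right: an element of \<open>C\<close>, and in
  front of it letters outside \<open>C\<close> from alternating factors. The list records only the
  factors, so that it can be compared with \<open>type_word\<close>.\<close>

inductive reduced :: "bool list \<Rightarrow> 'a \<Rightarrow> bool" where
  reduced_C: "c \<in> C \<Longrightarrow> reduced [] c"
| reduced_Cons: "x \<in> H s - C \<Longrightarrow> reduced w g \<Longrightarrow> w = [] \<or> hd w \<noteq> s \<Longrightarrow> reduced (s # w) (x \<otimes> g)"

lemma reduced_carrier: "reduced w g \<Longrightarrow> g \<in> carrier G"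
  by (induction rule: reduced.induct) (auto simp: C_carrier factor_carrier)

lemma reduced_type_word: "reduced w g \<Longrightarrow> type_word g = w"
proof (induction rule: reduced.induct)
  case (reduced_C c)
  then show ?case using type_word_C[of c \<one>] by (simp add: C_carrier type_word_one)
next
  case (reduced_Cons x s w g)
  then show ?case using type_word_Cons[of x s g] reduced_carrier by simp
qed

lemma reduced_single: "x \<in> H s - C \<Longrightarrow> reduced [s] x"
  using reduced_Cons[OF _ reduced_C[of \<one>], of x s] C
  factor_carrier[of x s] by (simp add: subgroup.one_closed)

lemma reduced_C_mult: "reduced w g \<Longrightarrow> c \<in> C \<Longrightarrow> reduced w (c \<otimes> g)"
proof (induction rule: reduced.induct)
  case (reduced_C d)
  then show ?case using C by (auto intro: reduced.reduced_C subgroup.m_closed)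
next
  case (reduced_Cons x s w g)
  then have x: "x \<in> carrier G" using factor_carrier by blast
  with reduced_Cons have "reduced (s # w) (c \<otimes> x \<otimes> g)"
    by (intro reduced.reduced_Cons) (auto simp: C_mult_iff C_factor factor_mult)
  then show ?case using reduced_Cons x by (simp add: m_assoc C_carrier reduced_carrier)
qed

text \<open>The letters that meet come from different factors, so nothing cancels; the element of
  \<open>C\<close> at the right end of \<open>g\<close> is absorbed by \<open>h\<close>.\<close>

lemma reduced_append:
  "reduced u g \<Longrightarrow> reduced v h \<Longrightarrow> u = [] \<or> v = [] \<or> last u \<noteq> hd v \<Longrightarrow> v \<noteq> [] \<Longrightarrow> reduced (u @ v) (g \<otimes> h)"
proof (induction u g rule: reduced.induct)
  case (reduced_C c)
  then show ?case by (simp add: reduced_C_mult)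
next
  case (reduced_Cons x s w g)
  then have "reduced (w @ v) (g \<otimes> h)" by (auto split: if_splits)
  then have "reduced (s # w @ v) (x \<otimes> (g \<otimes> h))"
    using reduced_Cons by (intro reduced.reduced_Cons) (cases w; auto)+
  then show ?case
    using reduced_Cons factor_carrier[of x s] by (simp add: m_assoc reduced_carrier)
qed

lemma reduced_inv: "reduced w g \<Longrightarrow> reduced (rev w) (inv g)"
proof (induction rule: reduced.induct)
  case (reduced_C c)
  then show ?case using C by (simp add: reduced.reduced_C subgroup.m_inv_closed)
next
  case (reduced_Cons x s w g)
  then have "reduced (rev w @ [s]) (inv g \<otimes> inv x)"
    by (intro reduced_append reduced_single factor_inv) (auto simp: last_rev)
  then show ?case
    using reduced_Cons factor_carrier[of x s] by (simp add: inv_mult_group reduced_carrier)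
qed

text \<open>A factor element multiplied from the left is absorbed if it is in \<open>C\<close>,
  becomes a new first letter, or merges with the first letter; a merged product that falls into
  \<open>C\<close> is absorbed by the remaining word.\<close>

lemma reduced_exists: "g \<in> carrier G \<Longrightarrow> \<exists>w. reduced w g"
proof -
  have "carrier G \<subseteq> {g. \<exists>w. reduced w g}"
  proof (rule generated)
    show "\<one> \<in> {g. \<exists>w. reduced w g}" using C by (auto intro: reduced_C subgroup.one_closed)
  next
    fix s x g assume x: "x \<in> H s" and "g \<in> {g. \<exists>w. reduced w g}"
    then obtain w where w: "reduced w g" by auto
    have "\<exists>w. reduced w (x \<otimes> g)"
    proof (cases "x \<in> C")
      case True
      then show ?thesis using w reduced_C_mult by blast
    next
      case x': False
      show ?thesis
      proof (cases "w = [] \<or> hd w \<noteq> s")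
        case True
        then show ?thesis using x x' w reduced_Cons[of x s w g] by blast
      next
        case False
        from w False obtain y v h where y: "y \<in> H s - C" "reduced v h" "w = s # v" "g = y \<otimes> h"
          "v = [] \<or> hd v \<noteq> s"
          by (cases rule: reduced.cases) auto
        then have eq: "x \<otimes> g = (x \<otimes> y) \<otimes> h"
          using x factor_carrier[of _ s] by (simp add: m_assoc reduced_carrier)
        have "x \<otimes> y \<in> H s" using x y by (simp add: factor_mult)
        then show ?thesis
          using y reduced_C_mult[of v h "x \<otimes> y"] reduced_Cons[of "x \<otimes> y" s v h] eq
          by (cases "x \<otimes> y \<in> C") auto
      qed
    qed
    then show "x \<otimes> g \<in> {g. \<exists>w. reduced w g}" by simp
  qed
  then show "g \<in> carrier G \<Longrightarrow> \<exists>w. reduced w g" by blast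
qed

text \<open>Conjugating by a letter of the factor opposite to the two ends adds a letter at each end
  without cancellation and keeps the ends equal. So lengths in the class are unbounded, and by
  \<open>reduced_type_word\<close> the length depends on the element only. As factors alternate,
  equal ends mean odd length.\<close>

lemma infinite_conj_class_odd:
  assumes g: "reduced w g" "w \<noteq> []" "hd w = last w"
  shows "infinite (conj_class G g)"
proof -
  have "\<exists>h v. h \<in> conj_class G g \<and> reduced v h \<and> v \<noteq> [] \<and> hd v = last v \<and> n < length v" for n
  proof (induction n)
    case 0
    have "g = \<one> \<otimes> g \<otimes> inv \<one>" using reduced_carrier[OF g(1)] by simp
    then have "g \<in> conj_class G g" unfolding conj_class_def by blast
    with g show ?case by auto
  next
    case (Suc n)
    then obtain h v where h: "h \<in> conj_class G g" "reduced v h" "v \<noteq> []" "hd v = last v" "n < length v"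
      by blast
    define s where "s = (\<not> hd v)"
    obtain x where x: "x \<in> H s - C" using C_less[of s] by blast
    have xG: "x \<in> carrier G" using x factor_carrier by auto
    have "reduced (([s] @ v) @ [s]) (x \<otimes> h \<otimes> inv x)"
      using h x by (intro reduced_append reduced_single factor_inv) (auto simp: s_def)
    moreover have "x \<otimes> h \<otimes> inv x \<in> conj_class G g"
    proof -
      have "conj_class G g = conj_class G h"
        using h(1) conj_class_conj[OF _ reduced_carrier[OF g(1)]] by (auto simp: conj_class_def[of G g])
      with xG show ?thesis by (auto simp: conj_class_def)
    qed
    ultimately show ?case using h(5) by (intro exI[of _ "x \<otimes> h \<otimes> inv x"] exI[of _ "[s] @ v @ [s]"]) auto
  qed
  then have "\<exists>h\<in>conj_class G g. n < length (type_word h)" for n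
    using reduced_type_word by blast
  then have "infinite ((\<lambda>h. length (type_word h)) ` conj_class G g)"
    unfolding infinite_nat_iff_unbounded by blast
  then show ?thesis by blast
qed

lemma infinite_carrier: "infinite (carrier G)"
proof -
  obtain x where x: "x \<in> H True - C" using C_less[of True] by blast
  have "conj_class G x \<subseteq> carrier G"
    using x factor_carrier[of x True] by (auto simp: conj_class_def)
  moreover have "infinite (conj_class G x)"
    using reduced_single[OF x] by (intro infinite_conj_class_odd) auto
  ultimately show ?thesis using finite_subset by blast
qed

text \<open>A suitable conjugation by an element of the factor of index greater than 2 makes the two
  ends of an even reduced word belong to the same factor.\<close>

lemma infinite_conj_class_outside_C:
  assumes big: "\<And>x. x \<in> H r - C \<Longrightarrow> \<exists>y\<in>H r - C. y \<otimes> x \<notin> C"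
    and g: "g \<in> carrier G" "g \<notin> C"
  shows "infinite (conj_class G g)"
proof -
  have even: "infinite (conj_class G h)"
    if h: "reduced w h" "w \<noteq> []" "hd w = r" "last w \<noteq> r" for w h
    using h(1)
  proof (cases rule: reduced.cases)
    case (reduced_Cons x s v k)
    then have v: "v \<noteq> []" "hd v \<noteq> r" "last v \<noteq> r" and x: "x \<in> H r - C" using h by (auto split: if_splits)
    \<comment> \<open>As \<open>y\<close> and \<open>y \<otimes> x\<close> are both outside
      \<open>C\<close>, conjugation by \<open>y\<close> turns the first letter into
      \<open>y \<otimes> x\<close> and appends \<open>inv y\<close>, so that both ends lie in
      \<open>H r\<close>.\<close>
    obtain y where y: "y \<in> H r - C" "y \<otimes> x \<notin> C" using big[OF x] by blast
    have car: "x \<in> carrier G" "y \<in> carrier G" "k \<in> carrier G"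
      using x y factor_carrier reduced_carrier reduced_Cons by auto
    have "y \<otimes> x \<in> H r - C" using x y factor_mult by auto
    then have "reduced (([r] @ v) @ [r]) (y \<otimes> x \<otimes> k \<otimes> inv y)"
      using reduced_Cons v y(1) by (intro reduced_append reduced_single factor_inv) auto
    then have "infinite (conj_class G (y \<otimes> x \<otimes> k \<otimes> inv y))"
      by (intro infinite_conj_class_odd) auto
    also have "y \<otimes> x \<otimes> k \<otimes> inv y = y \<otimes> h \<otimes> inv y"
      using car reduced_Cons by (simp add: m_assoc)
    finally show ?thesis using car reduced_Cons by (simp add: conj_class_conj)
  qed (use h in auto)
  obtain w where w: "reduced w g" using reduced_exists[OF g(1)] by blast
  then have "w \<noteq> []" using g(2) by (auto elim: reduced.cases)
  then consider "hd w = last w" | "hd w = r" "last w \<noteq> r" | "last w = r" "hd w \<noteq> r" by blast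
  then show ?thesis
  proof cases
    case 1
    then show ?thesis using infinite_conj_class_odd w \<open>w \<noteq> []\<close> by blast
  next
    case 2
    then show ?thesis using even w \<open>w \<noteq> []\<close> by blast
  next
    case 3
    \<comment> \<open>Inversion reverses the word, which then starts in \<open>H r\<close> and ends
      in the other factor.\<close>
    then have "infinite (conj_class G (inv g))"
      using reduced_inv[OF w] \<open>w \<noteq> []\<close> by (intro even[of "rev w"]) (auto simp: hd_rev last_rev)
    then show ?thesis using finite_conj_class_inv[OF g(1)] by blast
  qed
qed

end


section \<open>Subgroups of index 2\<close>

context group
begin

text \<open>With only two cosets, \<open>x\<close> and \<open>inv y\<close>, both outside
  \<open>K\<close>, share one.\<close>

lemma index_2_mult:
  assumes K: "subgroup K G" and card: "card (rcosets K) = 2"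
    and x: "x \<in> carrier G" "x \<notin> K" and y: "y \<in> carrier G" "y \<notin> K"
  shows "x \<otimes> y \<in> K"
proof -
  interpret K: subgroup K G by fact
  have cosets: "K \<in> rcosets K" "K #> x \<in> rcosets K" "K #> inv y \<in> rcosets K"
    using x y K.subset rcosetsI coset_mult_one by (metis K.subgroup_in_rcosets is_group, auto)
  have y': "inv y \<notin> K" using y K.m_inv_closed by fastforce
  have "K #> x \<noteq> K" "K #> inv y \<noteq> K"
    using x y y' rcos_self[OF _ K] by (metis inv_closed)+
  moreover obtain U V where "rcosets K = {U, V}" using card by (auto simp: card_2_iff)
  ultimately have "K #> x = K #> inv y" using cosets by auto
  then have "x \<in> K #> inv y" using rcos_self[OF x(1) K] by simp
  then obtain k where "k \<in> K" "x = k \<otimes> inv y" by (auto simp: r_coset_def)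
  then show ?thesis using y by (simp add: m_assoc)
qed

lemma index_2_proper:
  assumes K: "subgroup K G" and card: "card (rcosets K) = 2"
  shows "K \<noteq> carrier G"
proof
  assume eq: "K = carrier G"
  then have "rcosets K \<subseteq> {K}"
    using K coset_join2 by (auto simp: RCOSETS_def)
  then have "card (rcosets K) \<le> 1" using card_mono[of "{K}" "rcosets K"] by simp
  with card show False by simp
qed

lemma index_2_conj:
  assumes K: "subgroup K G" and card: "card (rcosets K) = 2"
    and x: "x \<in> carrier G" and k: "k \<in> K"
  shows "x \<otimes> k \<otimes> inv x \<in> K"
proof (cases "x \<in> K")
  case True
  then show ?thesis using K k by (simp add: subgroup.m_closed subgroup.m_inv_closed)
next
  case False
  interpret K: subgroup K G by fact
  have "x \<otimes> k \<notin> K"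
  proof
    assume "x \<otimes> k \<in> K"
    then have "x \<otimes> k \<otimes> inv k \<in> K" using k by simp
    then show False using False x k by (simp add: m_assoc)
  qed
  moreover have "inv x \<notin> K" using False x K.m_inv_closed by fastforce
  ultimately show ?thesis using x k by (intro index_2_mult[OF K card]) auto
qed

text \<open>A sign homomorphism with values in the group generated by \<open>d\<close>. The
  condition \<open>mult\<close> expresses index at most 2 in a form that applies both to
  \<open>C\<close> in a factor and to \<open>{0}\<close> in the integers modulo 2.\<close>

lemma index_2_hom:
  assumes K: "subgroup K G"
    and mult: "\<And>x y. x \<in> carrier G \<Longrightarrow> x \<notin> K \<Longrightarrow> y \<in> carrier G \<Longrightarrow> y \<notin> K \<Longrightarrow> x \<otimes> y \<in> K"
    and D: "group D" and d: "d \<in> carrier D" "d \<otimes>\<^bsub>D\<^esub> d = \<one>\<^bsub>D\<^esub>"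
  shows "(\<lambda>x. if x \<in> K then \<one>\<^bsub>D\<^esub> else d) \<in> hom G D"
proof -
  interpret K: subgroup K G by fact
  interpret D: group D by fact
  have "x \<otimes> y \<in> K \<longleftrightarrow> y \<in> K" if "x \<in> K" "y \<in> carrier G" for x y
    using that K.m_closed K.m_inv_closed by (metis K.mem_carrier inv_solve_left m_closed)
  moreover have "x \<otimes> y \<in> K \<longleftrightarrow> x \<in> K" if "y \<in> K" "x \<in> carrier G" for x y
    using that K.m_closed K.m_inv_closed by (metis K.mem_carrier inv_solve_right m_closed)
  ultimately show ?thesis using d mult by (intro homI) auto
qed

text \<open>If every \<open>y\<close> outside \<open>K\<close> had \<open>y \<otimes> x\<close> in
  \<open>K\<close>, it would lie in \<open>K #> inv x\<close>, leaving exactly two cosets. Infinite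
  index, where \<open>card\<close> is 0, is covered as well.\<close>

lemma not_index_2_avoid:
  assumes K: "subgroup K G" and card: "card (rcosets K) \<noteq> 2"
    and x: "x \<in> carrier G" "x \<notin> K"
  shows "\<exists>y\<in>carrier G - K. y \<otimes> x \<notin> K"
proof (rule ccontr)
  assume no: "\<not> ?thesis"
  interpret K: subgroup K G by fact
  have x': "inv x \<notin> K" using x K.m_inv_closed by fastforce
  have "K #> y \<in> {K, K #> inv x}" if y: "y \<in> carrier G" for y
  proof (cases "y \<in> K")
    case True
    then show ?thesis using y K coset_join2 by simp
  next
    case False
    then have "y \<otimes> x \<in> K" using no y by blast
    moreover have "y = (y \<otimes> x) \<otimes> inv x" using x y by (simp add: m_assoc)
    ultimately have "y \<in> K #> inv x" unfolding r_coset_def by blast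
    then show ?thesis using repr_independence[of y K "inv x"] x K by simp
  qed
  then have "rcosets K \<subseteq> {K, K #> inv x}" by (auto simp: RCOSETS_def)
  moreover have "K \<in> rcosets K" "K #> inv x \<in> rcosets K"
    using x K.subset rcosetsI K.subgroup_in_rcosets is_group by auto
  ultimately have "rcosets K = {K, K #> inv x}" by blast
  moreover have "K \<noteq> K #> inv x" using x x' rcos_self[OF _ K] by (metis inv_closed)
  ultimately show False using card by simp
qed

end


section \<open>Normal forms in amalgamated products\<close>

text \<open>Choosing from the coset rather than from \<open>x\<close> makes the value depend on the
  coset only. The coset \<open>K\<close> gets some element of \<open>K\<close>, not necessarily the
  identity; the normal forms use representatives of the other cosets only.\<close>

definition coset_rep :: "('a, 'm) monoid_scheme \<Rightarrow> 'a set \<Rightarrow> 'a \<Rightarrow> 'a"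
  where "coset_rep H K x = (SOME y. y \<in> K #>\<^bsub>H\<^esub> x)"

lemma coset_rep:
  fixes H (structure)
  assumes "group H" and K: "subgroup K H" and x: "x \<in> carrier H"
  shows coset_rep_carrier: "coset_rep H K x \<in> carrier H"
    and coset_rep_mult: "k \<in> K \<Longrightarrow> coset_rep H K (k \<otimes> x) = coset_rep H K x"
    and coset_rep_diff: "x \<otimes> inv (coset_rep H K x) \<in> K"
    and coset_rep_outside: "x \<notin> K \<Longrightarrow> coset_rep H K x \<notin> K"
proof -
  interpret group H by fact
  interpret K: subgroup K H by fact
  have "x \<in> K #> x" using x K by (rule rcos_self)
  then have "coset_rep H K x \<in> K #> x" unfolding coset_rep_def by (rule someI)
  then obtain k where k: "k \<in> K" "coset_rep H K x = k \<otimes> x" by (auto simp: r_coset_def)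
  then show "coset_rep H K x \<in> carrier H" using x by simp
  show "x \<otimes> inv (coset_rep H K x) \<in> K"
    using k x by (simp add: inv_mult_group flip: m_assoc)
  show "coset_rep H K x \<notin> K" if "x \<notin> K"
  proof
    assume "coset_rep H K x \<in> K"
    then have "inv k \<otimes> (k \<otimes> x) \<in> K" using k by simp
    then show False using that k x by (simp flip: m_assoc)
  qed
  show "coset_rep H K (k \<otimes> x) = coset_rep H K x" if "k \<in> K" for k
  proof -
    have "K #> (k \<otimes> x) = K #> x"
      using that x K by (simp add: coset_mult_assoc[symmetric] coset_join2 K.subset)
    then show ?thesis by (simp add: coset_rep_def)
  qed
qed

text \<open>
  Van der Waerden's trick: a state \<open>(c, [t\<^sub>1, \<dots>, t\<^sub>n])\<close> encodes the normal form \<open>c t\<^sub>1 \<dots> t\<^sub>n\<close>.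
  Merging \<open>c\<close> with \<open>t\<^sub>1\<close> if \<open>t\<^sub>1\<close> comes from the factor \<open>H\<close> identifies the states with pairs of an
  element of \<open>H\<close> and a list not starting in \<open>H\<close>, and \<open>H\<close> acts on the first component.
\<close>

lemma factor_action:
  fixes H :: "('h, 'm) monoid_scheme" (structure) and tag :: "'h \<Rightarrow> 'l"
    and V :: "'l list set" and K and \<psi> :: "'c \<Rightarrow> 'h" and S :: "'c set"
  defines "T \<equiv> coset_rep H K ` (carrier H - K)"
    and "Y \<equiv> {ws \<in> V. ws = [] \<or> hd ws \<notin> range tag}"
  assumes H: "group H" and K: "subgroup K H" and \<psi>: "bij_betw \<psi> S K" and tag: "inj tag"
    and Cons: "\<And>t ws. t \<in> T \<Longrightarrow> ws \<in> Y \<Longrightarrow> tag t # ws \<in> V"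
    and uncons: "\<And>ws. ws \<in> V - Y \<Longrightarrow> \<exists>t\<in>T. \<exists>vs\<in>Y. ws = tag t # vs"
  obtains act where
    "\<And>h z. h \<in> carrier H \<Longrightarrow> z \<in> S \<times> V \<Longrightarrow> act h z \<in> S \<times> V"
    "\<And>z. z \<in> S \<times> V \<Longrightarrow> act \<one> z = z"
    "\<And>g h z. g \<in> carrier H \<Longrightarrow> h \<in> carrier H \<Longrightarrow> z \<in> S \<times> V \<Longrightarrow> act (g \<otimes> h) z = act g (act h z)"
    "\<And>k c ws. k \<in> K \<Longrightarrow> c \<in> S \<Longrightarrow> ws \<in> V \<Longrightarrow> act k (c, ws) = (inv_into S \<psi> (k \<otimes> \<psi> c), ws)"
    "\<And>h c ws. h \<in> carrier H - K \<Longrightarrow> c \<in> S \<Longrightarrow> ws \<in> Y \<Longrightarrow> \<exists>c' t. act h (c, ws) = (c', tag t # ws)"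
proof -
  interpret group H by fact
  interpret K: subgroup K H by fact
  note rep = coset_rep[OF H K]
  define \<psi>' where "\<psi>' = inv_into S \<psi>"
  have \<psi>': "\<psi>' k \<in> S" "\<psi> (\<psi>' k) = k" if "k \<in> K" for k
    using \<psi> that by (auto simp: \<psi>'_def bij_betw_def inv_into_into f_inv_into_f)
  have \<psi>_K: "\<psi> c \<in> K" "\<psi>' (\<psi> c) = c" if "c \<in> S" for c
    using \<psi> that by (auto simp: \<psi>'_def bij_betw_def)
  \<comment> \<open>The merged pair is split again: \<open>x\<close> outside \<open>K\<close> is
    written as an element of \<open>K\<close> times its coset representative, which becomes the
    first letter; \<open>x\<close> in \<open>K\<close> contributes no letter.\<close>
  define enc where "enc = (\<lambda>(x, ws). if x \<in> K then (\<psi>' x, ws)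
    else (\<psi>' (x \<otimes> inv (coset_rep H K x)), tag (coset_rep H K x) # ws))"
  have enc_K: "enc (x, ws) = (\<psi>' x, ws)" if "x \<in> K" for x ws
    using that by (simp add: enc_def)
  have enc_not_K: "enc (x, ws) = (\<psi>' (x \<otimes> inv (coset_rep H K x)), tag (coset_rep H K x) # ws)"
    if "x \<notin> K" for x ws
    using that by (simp add: enc_def)
  have inj: "inj_on enc (carrier H \<times> Y)"
  proof (rule inj_onI)
    fix z z' assume z: "z \<in> carrier H \<times> Y" "z' \<in> carrier H \<times> Y" and eq: "enc z = enc z'"
    obtain x ws where zx: "z = (x, ws)" "x \<in> carrier H" "ws \<in> Y" using z by blast
    obtain y vs where zy: "z' = (y, vs)" "y \<in> carrier H" "vs \<in> Y" using z by blast
    have same: "x \<in> K \<longleftrightarrow> y \<in> K"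
      using eq zx zy by (cases "x \<in> K"; cases "y \<in> K") (auto simp: enc_K enc_not_K Y_def)
    show "z = z'"
    proof (cases "x \<in> K")
      case True
      then show ?thesis using eq same zx zy \<psi>' by (simp add: enc_K) metis
    next
      case False
      then have "coset_rep H K x = coset_rep H K y" "ws = vs"
        and "\<psi>' (x \<otimes> inv (coset_rep H K x)) = \<psi>' (y \<otimes> inv (coset_rep H K y))"
        using eq same zx zy tag by (auto simp: enc_not_K dest: injD)
      moreover from this have "x \<otimes> inv (coset_rep H K x) = y \<otimes> inv (coset_rep H K x)"
        using \<psi>' rep(3) zx(2) zy(2) by metis
      ultimately show ?thesis using zx zy rep(1)[OF zx(2)] by simp
    qed
  qed
  have enc_closed: "enc z \<in> S \<times> V" if "z \<in> carrier H \<times> Y" for z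
    using that \<psi>' rep(3) Cons by (auto simp: enc_def T_def Y_def)
  have surj: "\<exists>z\<in>carrier H \<times> Y. enc z = (c, ws)" if c: "c \<in> S" and ws: "ws \<in> V" for c ws
  proof (cases "ws \<in> Y")
    case True
    then show ?thesis using c \<psi>_K by (intro bexI[of _ "(\<psi> c, ws)"]) (auto simp: enc_K)
  next
    case False
    then obtain x vs where x: "x \<in> carrier H - K" "vs \<in> Y" "ws = tag (coset_rep H K x) # vs"
      using ws uncons[of ws] unfolding T_def by blast
    let ?t = "coset_rep H K x"
    have t: "?t \<in> carrier H" using rep(1) x by auto
    \<comment> \<open>Merging the \<open>K\<close>-part with the first letter inverts
      \<open>enc\<close>; \<open>y\<close> lies in the coset of \<open>x\<close>, so its
      representative is again \<open>?t\<close>.\<close>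
    define y where "y = \<psi> c \<otimes> ?t"
    have y: "y \<in> carrier H" using t \<psi>_K(1)[OF c] by (simp add: y_def)
    have "y = (\<psi> c \<otimes> inv (x \<otimes> inv ?t)) \<otimes> x"
      using x t \<psi>_K(1)[OF c] by (simp add: y_def inv_mult_group m_assoc)
    moreover have k: "\<psi> c \<otimes> inv (x \<otimes> inv ?t) \<in> K"
      using \<psi>_K(1)[OF c] rep(3)[of x] x by simp
    ultimately have rep_y: "coset_rep H K y = ?t" using rep(2) x by auto
    have "y \<notin> K"
    proof
      assume "y \<in> K"
      then have "inv (\<psi> c) \<otimes> y \<in> K" using \<psi>_K(1)[OF c] by simp
      then show False using rep(4)[of x] x t \<psi>_K(1)[OF c] by (simp add: y_def flip: m_assoc)
    qed
    moreover have "y \<otimes> inv ?t = \<psi> c" using t \<psi>_K(1)[OF c] by (simp add: y_def m_assoc)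
    ultimately show ?thesis
      using x y c \<psi>_K(2) by (intro bexI[of _ "(y, vs)"]) (auto simp: enc_not_K rep_y)
  qed
  \<comment> \<open>Left multiplication on the first component, transported along the bijection
    \<open>enc\<close>.\<close>
  define act where "act h z = (case inv_into (carrier H \<times> Y) enc z of (x, ws) \<Rightarrow> enc (h \<otimes> x, ws))"
    for h z
  have act: "act h (enc (x, ws)) = enc (h \<otimes> x, ws)" if "x \<in> carrier H" "ws \<in> Y" for h x ws
    using that inj by (simp add: act_def)
  have decode: "\<exists>x ws. z = enc (x, ws) \<and> x \<in> carrier H \<and> ws \<in> Y" if "z \<in> S \<times> V" for z
    using surj that by (metis SigmaE2 mem_Sigma_iff surj_pair)
  show thesis
  proof
    fix h z assume "h \<in> carrier H" "z \<in> S \<times> V"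
    then show "act h z \<in> S \<times> V" using decode[of z] act enc_closed by fastforce
  next
    fix z assume "z \<in> S \<times> V"
    then show "act \<one> z = z" using decode[of z] act by auto
  next
    fix g h z assume "g \<in> carrier H" "h \<in> carrier H" "z \<in> S \<times> V"
    then show "act (g \<otimes> h) z = act g (act h z)" using decode[of z] act by (auto simp: m_assoc)
  next
    fix k c ws assume k: "k \<in> K" and c: "c \<in> S" "ws \<in> V"
    obtain x vs where x: "(c, ws) = enc (x, vs)" "x \<in> carrier H" "vs \<in> Y"
      using decode c by (metis mem_Sigma_iff)
    \<comment> \<open>Multiplication by \<open>k\<close> from the left stays in the same coset of
      \<open>K\<close>, so the first letter is unchanged and only the \<open>K\<close>-part
      moves.\<close>
    have kx: "k \<otimes> x \<in> K \<longleftrightarrow> x \<in> K"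
    proof
      assume "k \<otimes> x \<in> K"
      then have "inv k \<otimes> (k \<otimes> x) \<in> K" using k by simp
      then show "x \<in> K" using k x(2) by (simp flip: m_assoc)
    qed (use k in simp)
    have "enc (k \<otimes> x, vs) = (\<psi>' (k \<otimes> \<psi> c), ws)"
    proof (cases "x \<in> K")
      case True
      then show ?thesis using x kx \<psi>' by (simp add: enc_K)
    next
      case False
      then have c_eq: "c = \<psi>' (x \<otimes> inv (coset_rep H K x))" "ws = tag (coset_rep H K x) # vs"
        using x by (auto simp: enc_not_K)
      then have "\<psi> c = x \<otimes> inv (coset_rep H K x)" using \<psi>' rep(3) x(2) by simp
      then show ?thesis
        using False k kx c_eq(2) rep(1)[OF x(2)] rep(2)[OF x(2) k] x(2) by (simp add: enc_not_K m_assoc)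
    qed
    then show "act k (c, ws) = (inv_into S \<psi> (k \<otimes> \<psi> c), ws)"
      using x act by (simp add: \<psi>'_def)
  next
    fix h c ws assume h: "h \<in> carrier H - K" and c: "c \<in> S" "ws \<in> Y"
    have "(c, ws) = enc (\<psi> c, ws)" using c \<psi>_K by (simp add: enc_K)
    then have eq: "act h (c, ws) = enc (h \<otimes> \<psi> c, ws)" using c act \<psi>_K by simp
    have "h \<otimes> \<psi> c \<notin> K"
    proof
      assume "h \<otimes> \<psi> c \<in> K"
      then have "h \<otimes> \<psi> c \<otimes> inv (\<psi> c) \<in> K" using \<psi>_K c by simp
      then show False using h \<psi>_K(1)[OF c(1)] by (simp add: m_assoc)
    qed
    then have "act h (c, ws) = (\<psi>' (h \<otimes> \<psi> c \<otimes> inv coset_rep H K (h \<otimes> \<psi> c)), tag (coset_rep H K (h \<otimes> \<psi> c)) # ws)"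
      by (simp add: eq enc_not_K)
    then show "\<exists>c' t. act h (c, ws) = (c', tag t # ws)" by blast
  qed
qed

section \<open>Amalgamated products: action on normal forms\<close>

context
  fixes A :: "('a, 'm) monoid_scheme" and B :: "('b, 'n) monoid_scheme"
    and C :: "'a set" and C' :: "'b set" and \<phi> :: "'a \<Rightarrow> 'b"
  assumes A: "group A" and B: "group B" and C: "subgroup C A" and C': "subgroup C' B"
    and \<phi>: "\<phi> \<in> iso (A\<lparr>carrier := C\<rparr>) (B\<lparr>carrier := C'\<rparr>)"
begin

interpretation A: group A by (rule A)
interpretation B: group B by (rule B)
interpretation C: subgroup C A by (rule C)
interpretation C': subgroup C' B by (rule C')

private abbreviation "R \<equiv> (\<lambda>c. (c, \<phi> c)) ` C"
private abbreviation "G \<equiv> amalgamated_product A B C \<phi>"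
private abbreviation "\<iota> \<equiv> amalg_inl A B C \<phi>"
private abbreviation "\<kappa> \<equiv> fpi_inr A B R"

text \<open>Both factors act on the same set of normal forms, and their actions agree on
  \<open>C\<close> and \<open>C'\<close>; hence congruent words act alike. \<open>state g\<close> is
  the result of \<open>g\<close> acting on the normal form of the identity.\<close>

lemma amalgam_states:
  obtains state :: "('a + 'b) list set \<Rightarrow> 'a \<times> ('a + 'b) list" where
    "state \<one>\<^bsub>G\<^esub> = (\<one>\<^bsub>A\<^esub>, [])"
    "\<And>c g. c \<in> C \<Longrightarrow> g \<in> carrier G \<Longrightarrow>
      state (\<iota> c \<otimes>\<^bsub>G\<^esub> g) = (c \<otimes>\<^bsub>A\<^esub> fst (state g), snd (state g))"
    "\<And>a g. a \<in> carrier A - C \<Longrightarrow> g \<in> carrier G \<Longrightarrow> snd (state g) = [] \<or> \<not> isl (hd (snd (state g)))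
      \<Longrightarrow> \<exists>c t. state (\<iota> a \<otimes>\<^bsub>G\<^esub> g) = (c, Inl t # snd (state g))"
    "\<And>b g. b \<in> carrier B - C' \<Longrightarrow> g \<in> carrier G \<Longrightarrow> snd (state g) = [] \<or> isl (hd (snd (state g)))
      \<Longrightarrow> \<exists>c t. state (\<kappa> b \<otimes>\<^bsub>G\<^esub> g) = (c, Inr t # snd (state g))"
proof -
  let ?W = "lists (letters A B)" and ?E = "word_cong A B R"
  have bij: "bij_betw \<phi> C C'" using \<phi> by (simp add: iso_def)
  have \<phi>_mult: "\<phi> (c \<otimes>\<^bsub>A\<^esub> d) = \<phi> c \<otimes>\<^bsub>B\<^esub> \<phi> d" if "c \<in> C" "d \<in> C" for c d
    using \<phi> that by (simp add: iso_def hom_def)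
  have \<phi>_C': "\<phi> c \<in> C'" if "c \<in> C" for c using bij that by (auto simp: bij_betw_def)
  define T\<^sub>A T\<^sub>B where "T\<^sub>A = coset_rep A C ` (carrier A - C)" and "T\<^sub>B = coset_rep B C' ` (carrier B - C')"
  \<comment> \<open>Lists of coset representatives that come alternately from the two
    factors.\<close>
  define V where "V = {ws. distinct_adj (map isl ws) \<and> set ws \<subseteq> Inl ` T\<^sub>A \<union> Inr ` T\<^sub>B}"
  define \<S> where "\<S> = C \<times> V"
  have range: "l \<in> range Inl \<longleftrightarrow> isl l" "l \<in> range Inr \<longleftrightarrow> \<not> isl l" for l :: "'a + 'b"
    by (cases l; auto)+
  \<comment> \<open>States keep their first component in \<open>C\<close>. The factor
    \<open>A\<close> reads it through the identity map, the factor \<open>B\<close> through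
    \<open>\<phi>\<close>.\<close>
  obtain actA where actA:
    "\<And>h z. h \<in> carrier A \<Longrightarrow> z \<in> \<S> \<Longrightarrow> actA h z \<in> \<S>"
    "\<And>z. z \<in> \<S> \<Longrightarrow> actA \<one>\<^bsub>A\<^esub> z = z"
    "\<And>g h z. g \<in> carrier A \<Longrightarrow> h \<in> carrier A \<Longrightarrow> z \<in> \<S> \<Longrightarrow> actA (g \<otimes>\<^bsub>A\<^esub> h) z = actA g (actA h z)"
    "\<And>k c ws. k \<in> C \<Longrightarrow> c \<in> C \<Longrightarrow> ws \<in> V \<Longrightarrow> actA k (c, ws) = (inv_into C (\<lambda>x. x) (k \<otimes>\<^bsub>A\<^esub> c), ws)"
    "\<And>h c ws. h \<in> carrier A - C \<Longrightarrow> c \<in> C \<Longrightarrow> ws \<in> {ws \<in> V. ws = [] \<or> hd ws \<notin> range Inl}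
      \<Longrightarrow> \<exists>c' t. actA h (c, ws) = (c', Inl t # ws)"
  proof (rule factor_action[OF A C, of "\<lambda>x. x" C "Inl :: 'a \<Rightarrow> 'a + 'b" V, folded T\<^sub>A_def \<S>_def])
    fix ws assume "ws \<in> V - {ws \<in> V. ws = [] \<or> hd ws \<notin> range (Inl :: 'a \<Rightarrow> 'a + 'b)}"
    then show "\<exists>t\<in>T\<^sub>A. \<exists>vs\<in>{ws \<in> V. ws = [] \<or> hd ws \<notin> range (Inl :: 'a \<Rightarrow> 'a + 'b)}. ws = Inl t # vs"
      unfolding range by (cases ws) (auto simp: V_def distinct_adj_Cons hd_map isl_def)
  next
    fix t ws assume "t \<in> T\<^sub>A" "ws \<in> {ws \<in> V. ws = [] \<or> hd ws \<notin> range (Inl :: 'a \<Rightarrow> 'a + 'b)}"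
    then show "Inl t # ws \<in> V"
      unfolding range by (cases ws) (auto simp: V_def)
  qed (auto simp: bij_betw_def)
  obtain actB where actB:
    "\<And>h z. h \<in> carrier B \<Longrightarrow> z \<in> \<S> \<Longrightarrow> actB h z \<in> \<S>"
    "\<And>z. z \<in> \<S> \<Longrightarrow> actB \<one>\<^bsub>B\<^esub> z = z"
    "\<And>g h z. g \<in> carrier B \<Longrightarrow> h \<in> carrier B \<Longrightarrow> z \<in> \<S> \<Longrightarrow> actB (g \<otimes>\<^bsub>B\<^esub> h) z = actB g (actB h z)"
    "\<And>k c ws. k \<in> C' \<Longrightarrow> c \<in> C \<Longrightarrow> ws \<in> V \<Longrightarrow> actB k (c, ws) = (inv_into C \<phi> (k \<otimes>\<^bsub>B\<^esub> \<phi> c), ws)"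
    "\<And>h c ws. h \<in> carrier B - C' \<Longrightarrow> c \<in> C \<Longrightarrow> ws \<in> {ws \<in> V. ws = [] \<or> hd ws \<notin> range Inr}
      \<Longrightarrow> \<exists>c' t. actB h (c, ws) = (c', Inr t # ws)"
  proof (rule factor_action[OF B C', of \<phi> C "Inr :: 'b \<Rightarrow> 'a + 'b" V, folded T\<^sub>B_def \<S>_def])
    fix ws assume "ws \<in> V - {ws \<in> V. ws = [] \<or> hd ws \<notin> range (Inr :: 'b \<Rightarrow> 'a + 'b)}"
    then show "\<exists>t\<in>T\<^sub>B. \<exists>vs\<in>{ws \<in> V. ws = [] \<or> hd ws \<notin> range (Inr :: 'b \<Rightarrow> 'a + 'b)}. ws = Inr t # vs"
      unfolding range by (cases ws) (auto simp: V_def distinct_adj_Cons hd_map isl_def)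
  next
    fix t ws assume "t \<in> T\<^sub>B" "ws \<in> {ws \<in> V. ws = [] \<or> hd ws \<notin> range (Inr :: 'b \<Rightarrow> 'a + 'b)}"
    then show "Inr t # ws \<in> V"
      unfolding range by (cases ws) (auto simp: V_def)
  qed (auto simp: bij)
  have actA_C: "actA k (c, ws) = (k \<otimes>\<^bsub>A\<^esub> c, ws)" if "k \<in> C" "c \<in> C" "ws \<in> V" for k c ws
    using actA(4)[OF that] that inv_into_f_f[of "\<lambda>x. x" C "k \<otimes>\<^bsub>A\<^esub> c"] by simp
  have actB_C: "actB (\<phi> k) (c, ws) = (k \<otimes>\<^bsub>A\<^esub> c, ws)" if "k \<in> C" "c \<in> C" "ws \<in> V" for k c ws
    using actB(4)[OF \<phi>_C'[OF that(1)] that(2,3)] that inv_into_f_f[of \<phi> C "k \<otimes>\<^bsub>A\<^esub> c"] bij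
    by (simp add: bij_betw_def \<phi>_mult)
  define run where "run = foldr (case_sum actA actB)"
  have run_closed: "run w z \<in> \<S>" if "w \<in> ?W" "z \<in> \<S>" for w z
    using that by (induction w) (auto simp: run_def letters_def actA(1) actB(1))
  have run_cong: "\<forall>z\<in>\<S>. run u z = run v z" if "(u, v) \<in> ?E" for u v
    using that
  proof (induction rule: word_cong.induct)
    case (wc_append u u' v v')
    then show ?case
      using run_closed word_cong_words[OF A B wc_append.hyps(2)] by (simp add: run_def)
  next
    case (wc_ident c d)
    then show ?case using actA_C actB_C by (auto simp: run_def \<S>_def)
  qed (simp_all add: run_def actA(2,3) actB(2,3))
  \<comment> \<open>By \<open>run_cong\<close> any word representing the element gives the same
    state.\<close>
  define state where "state S = run (SOME w. w \<in> S) (\<one>\<^bsub>A\<^esub>, [])" for S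
  have base: "(\<one>\<^bsub>A\<^esub>, []) \<in> \<S>" by (simp add: \<S>_def V_def)
  have state_class: "state (?E `` {w}) = run w (\<one>\<^bsub>A\<^esub>, [])" if "w \<in> ?W" for w
  proof -
    have "(SOME v. v \<in> ?E `` {w}) \<in> ?E `` {w}"
      using wc_refl[OF that] by (intro someI[of "\<lambda>v. v \<in> ?E `` {w}" w]) auto
    then show ?thesis unfolding state_def using run_cong base by auto
  qed
  have G: "g \<in> carrier G \<Longrightarrow> \<exists>w\<in>?W. g = ?E `` {w}" for g
    by (auto simp: amalgamated_product_def fpi_carrier[OF A B])
  have state_closed: "state g \<in> \<S>" if "g \<in> carrier G" for g
    using G[OF that] state_class run_closed base by force
  have state_letter: "state (?E `` {[l]} \<otimes>\<^bsub>G\<^esub> g) = case_sum actA actB l (state g)"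
    if l: "l \<in> letters A B" and g: "g \<in> carrier G" for l g
  proof -
    obtain w where w: "w \<in> ?W" "g = ?E `` {w}" using G[OF g] by blast
    then have "?E `` {[l]} \<otimes>\<^bsub>G\<^esub> g = ?E `` {l # w}"
      using fpi_mult[OF A B, of "[l]" w] l by (simp add: amalgamated_product_def)
    then show ?thesis using w l state_class by (simp add: run_def)
  qed
  show thesis
  proof
    show "state \<one>\<^bsub>G\<^esub> = (\<one>\<^bsub>A\<^esub>, [])"
      by (simp add: amalgamated_product_def fpi_one[OF A B] state_class run_def)
  next
    fix c g assume c: "c \<in> C" and g: "g \<in> carrier G"
    then show "state (\<iota> c \<otimes>\<^bsub>G\<^esub> g) = (c \<otimes>\<^bsub>A\<^esub> fst (state g), snd (state g))"
      using state_letter[of "Inl c" g] state_closed[OF g] actA_C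
      by (auto simp: amalg_inl_def fpi_inl_def letters_def \<S>_def)
  next
    fix a g assume "a \<in> carrier A - C" and g: "g \<in> carrier G"
      and "snd (state g) = [] \<or> \<not> isl (hd (snd (state g)))"
    then show "\<exists>c t. state (\<iota> a \<otimes>\<^bsub>G\<^esub> g) = (c, Inl t # snd (state g))"
      using state_letter[of "Inl a" g] state_closed[OF g] actA(5)[of a "fst (state g)" "snd (state g)"]
      unfolding range by (auto simp: amalg_inl_def fpi_inl_def letters_def \<S>_def)
  next
    fix b g assume "b \<in> carrier B - C'" and g: "g \<in> carrier G"
      and "snd (state g) = [] \<or> isl (hd (snd (state g)))"
    then show "\<exists>c t. state (\<kappa> b \<otimes>\<^bsub>G\<^esub> g) = (c, Inr t # snd (state g))"
      using state_letter[of "Inr b" g] state_closed[OF g] actB(5)[of b "fst (state g)" "snd (state g)"]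
      unfolding range by (auto simp: fpi_inr_def letters_def \<S>_def)
  qed
qed


section \<open>Amalgamated products: position of the factors and reduced words\<close>

private lemma group_G: "group G"
  unfolding amalgamated_product_def by (rule group_free_product_ident[OF A B])

interpretation G: group G by (rule group_G)

private lemma amalgam_carrier_subset:
  assumes "\<one>\<^bsub>G\<^esub> \<in> S"
    and "\<And>a g. a \<in> carrier A \<Longrightarrow> g \<in> S \<Longrightarrow> g \<in> carrier G \<Longrightarrow> \<iota> a \<otimes>\<^bsub>G\<^esub> g \<in> S"
    and "\<And>b g. b \<in> carrier B \<Longrightarrow> g \<in> S \<Longrightarrow> g \<in> carrier G \<Longrightarrow> \<kappa> b \<otimes>\<^bsub>G\<^esub> g \<in> S"
  shows "carrier G \<subseteq> S"
  by (rule fpi_carrier_subset[OF A B, of R, folded amalgamated_product_def amalg_inl_def])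
    (rule assms; assumption)+

private lemma \<iota>_hom: "\<iota> \<in> hom A G"
  unfolding amalg_inl_def amalgamated_product_def by (rule fpi_inl_hom[OF A B])

private lemma \<kappa>_hom: "\<kappa> \<in> hom B G"
  unfolding amalgamated_product_def by (rule fpi_inr_hom[OF A B])

interpretation \<iota>: group_hom A G \<iota> by unfold_locales (rule \<iota>_hom)
interpretation \<kappa>: group_hom B G \<kappa> by unfold_locales (rule \<kappa>_hom)

private lemma \<phi>_image: "\<phi> ` C = C'"
  using \<phi> by (simp add: iso_def bij_betw_def)

lemma amalgam_identified: "c \<in> C \<Longrightarrow> \<kappa> (\<phi> c) = \<iota> c"
  unfolding amalg_inl_def using \<phi>_image C'.subset
  by (intro fpi_ident[OF A B, symmetric]) auto

text \<open>Applied to the identity, an element \<open>c\<close> of \<open>C\<close> yields the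
  state with first component \<open>c\<close> and no letters, while a factor element outside the
  amalgamated subgroup yields one letter. States thus separate all these cases.\<close>

lemma amalgam_factors_outside:
  shows "a \<in> carrier A \<Longrightarrow> \<iota> a \<in> \<iota> ` C \<longleftrightarrow> a \<in> C"
    and "b \<in> carrier B \<Longrightarrow> \<kappa> b \<in> \<iota> ` C \<longleftrightarrow> b \<in> C'"
    and inj_on_amalg_inl: "inj_on \<iota> C"
proof -
  obtain state :: "('a + 'b) list set \<Rightarrow> 'a \<times> ('a + 'b) list" where state: "state \<one>\<^bsub>G\<^esub> = (\<one>\<^bsub>A\<^esub>, [])"
    "\<And>c g. c \<in> C \<Longrightarrow> g \<in> carrier G \<Longrightarrow>
      state (\<iota> c \<otimes>\<^bsub>G\<^esub> g) = (c \<otimes>\<^bsub>A\<^esub> fst (state g), snd (state g))"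
    "\<And>a g. a \<in> carrier A - C \<Longrightarrow> g \<in> carrier G \<Longrightarrow> snd (state g) = [] \<or> \<not> isl (hd (snd (state g)))
      \<Longrightarrow> \<exists>c t. state (\<iota> a \<otimes>\<^bsub>G\<^esub> g) = (c, Inl t # snd (state g))"
    "\<And>b g. b \<in> carrier B - C' \<Longrightarrow> g \<in> carrier G \<Longrightarrow> snd (state g) = [] \<or> isl (hd (snd (state g)))
      \<Longrightarrow> \<exists>c t. state (\<kappa> b \<otimes>\<^bsub>G\<^esub> g) = (c, Inr t # snd (state g))"
  proof (rule amalgam_states, goal_cases)
    case (1 state)
    from 1(2-5) show ?case by (rule that[of state])
  qed
  have C_empty: "snd (state g) = []" if "g \<in> \<iota> ` C" for g
    using that state(1) state(2)[of _ "\<one>\<^bsub>G\<^esub>"] by auto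
  have "fst (state (\<iota> c)) = c" if "c \<in> C" for c
    using state(1) state(2)[of c "\<one>\<^bsub>G\<^esub>"] that by simp
  then show "inj_on \<iota> C" by (rule inj_on_inverseI)
  have "snd (state (\<iota> a)) \<noteq> []" if "a \<in> carrier A - C"
    using state(3)[OF that, of "\<one>\<^bsub>G\<^esub>"] state(1) that by auto
  then show "\<iota> a \<in> \<iota> ` C \<longleftrightarrow> a \<in> C" if "a \<in> carrier A"
    using C_empty that by blast
  have "snd (state (\<kappa> b)) \<noteq> []" if "b \<in> carrier B - C'"
    using state(4)[OF that, of "\<one>\<^bsub>G\<^esub>"] state(1) that by auto
  moreover have "\<kappa> b \<in> \<iota> ` C" if "b \<in> C'"
    using that \<phi>_image amalgam_identified by auto
  ultimately show "\<kappa> b \<in> \<iota> ` C \<longleftrightarrow> b \<in> C'" if "b \<in> carrier B"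
    using C_empty that by blast
qed

lemma amalgamated_product_amalgam:
  assumes "C \<noteq> carrier A" "C' \<noteq> carrier B"
  obtains type_word where
    "amalgam G (\<lambda>s. if s then \<iota> ` carrier A else \<kappa> ` carrier B) (\<iota> ` C) type_word"
proof (rule amalgam_states, goal_cases)
  case (1 state)
  note state = 1(2-5)
  \<comment> \<open>Only the factor of each letter is kept; \<open>isl\<close> sends letters of
    \<open>A\<close> to \<open>True\<close>, in accordance with the indexing of the factors.\<close>
  define tw where "tw g = map isl (snd (state g))" for g
  show ?case
  proof (rule that[of tw], intro amalgam.intro amalgam_axioms.intro)
    show "group G" by (rule group_G)
  next
    fix s
    show "subgroup (if s then \<iota> ` carrier A else \<kappa> ` carrier B) G"
      using \<iota>.img_is_subgroup \<kappa>.img_is_subgroup by simp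
    show "subgroup (\<iota> ` C) G" by (rule \<iota>.subgroup_img_is_subgroup[OF C])
    have "\<iota> c \<in> \<kappa> ` carrier B" if "c \<in> C" for c
      using amalgam_identified[OF that] \<phi>_image C'.subset that
      by (intro image_eqI[of _ _ "\<phi> c"]) auto
    then have sub: "\<iota> ` C \<subseteq> \<kappa> ` carrier B" by blast
    obtain a b where "a \<in> carrier A - C" "b \<in> carrier B - C'"
      using assms C.subset C'.subset by blast
    then have "\<iota> a \<in> \<iota> ` carrier A - \<iota> ` C" "\<kappa> b \<in> \<kappa> ` carrier B - \<iota> ` C"
      by (simp_all add: amalgam_factors_outside)
    then show "\<iota> ` C \<subset> (if s then \<iota> ` carrier A else \<kappa> ` carrier B)"
      using sub C.subset by auto
  next
    fix S
    assume one: "\<one>\<^bsub>G\<^esub> \<in> S"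
      and step: "\<And>s x g. x \<in> (if s then \<iota> ` carrier A else \<kappa> ` carrier B) \<Longrightarrow>
        g \<in> S \<Longrightarrow> g \<in> carrier G \<Longrightarrow> x \<otimes>\<^bsub>G\<^esub> g \<in> S"
    show "carrier G \<subseteq> S"
    proof (rule amalgam_carrier_subset[OF one])
      show "\<iota> a \<otimes>\<^bsub>G\<^esub> g \<in> S" if "a \<in> carrier A" "g \<in> S" "g \<in> carrier G" for a g
        using that by (intro step[of _ True]) simp_all
      show "\<kappa> b \<otimes>\<^bsub>G\<^esub> g \<in> S" if "b \<in> carrier B" "g \<in> S" "g \<in> carrier G" for b g
        using that by (intro step[of _ False]) simp_all
    qed
  next
    show "tw \<one>\<^bsub>G\<^esub> = []" by (simp add: tw_def state(1))
  next
    fix c g assume "c \<in> \<iota> ` C" "g \<in> carrier G"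
    then show "tw (c \<otimes>\<^bsub>G\<^esub> g) = tw g" by (auto simp: tw_def state(2))
  next
    fix x s g assume x: "x \<in> (if s then \<iota> ` carrier A else \<kappa> ` carrier B) - \<iota> ` C"
      and g: "g \<in> carrier G" and hd: "tw g = [] \<or> hd (tw g) \<noteq> s"
    have hd': "snd (state g) = [] \<or> isl (hd (snd (state g))) \<noteq> s"
      using hd by (cases "snd (state g)") (auto simp: tw_def)
    show "tw (x \<otimes>\<^bsub>G\<^esub> g) = s # tw g"
    proof (cases s)
      case True
      then obtain a where a: "a \<in> carrier A - C" "x = \<iota> a" using x by auto
      then show ?thesis
        using state(3)[OF a(1) g] hd' True a(2) by (auto simp: tw_def)
    next
      case False
      then obtain b where b: "b \<in> carrier B - C'" "x = \<kappa> b"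
        using x amalgam_factors_outside(2) by auto
      then show ?thesis
        using state(4)[OF b(1) g] hd' False b(2) by (auto simp: tw_def)
    qed
  qed
qed

section \<open>Degenerate amalgams: normality and the dihedral quotient\<close>

text \<open>Each factor normalizes the amalgamated subgroup because the index is 2; the elements
  conjugating it into itself are stable under left multiplication by both factors, hence make up all
  of \<open>G\<close>.\<close>

lemma amalgam_normal_if_index_2:
  assumes "card (rcosets\<^bsub>A\<^esub> C) = 2" "card (rcosets\<^bsub>B\<^esub> C') = 2"
  shows "\<iota> ` C \<lhd> G"
proof -
  have gen: "x \<otimes>\<^bsub>G\<^esub> c \<otimes>\<^bsub>G\<^esub> inv\<^bsub>G\<^esub> x \<in> \<iota> ` C"
    if x: "x \<in> \<iota> ` carrier A \<union> \<kappa> ` carrier B" and c: "c \<in> \<iota> ` C" for x c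
    using x
  proof
    assume "x \<in> \<iota> ` carrier A"
    then obtain a d where ad: "a \<in> carrier A" "x = \<iota> a" "d \<in> C" "c = \<iota> d" using c by blast
    then have "x \<otimes>\<^bsub>G\<^esub> c \<otimes>\<^bsub>G\<^esub> inv\<^bsub>G\<^esub> x = \<iota> (a \<otimes>\<^bsub>A\<^esub> d \<otimes>\<^bsub>A\<^esub> inv\<^bsub>A\<^esub> a)" by simp
    with A.index_2_conj[OF C assms(1)] ad show ?thesis by blast
  next
    assume "x \<in> \<kappa> ` carrier B"
    then obtain b d where bd: "b \<in> carrier B" "x = \<kappa> b" "d \<in> C'" "c = \<kappa> d"
      using c amalgam_identified \<phi>_image by fastforce
    then have eq: "x \<otimes>\<^bsub>G\<^esub> c \<otimes>\<^bsub>G\<^esub> inv\<^bsub>G\<^esub> x = \<kappa> (b \<otimes>\<^bsub>B\<^esub> d \<otimes>\<^bsub>B\<^esub> inv\<^bsub>B\<^esub> b)" by simp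
    have "b \<otimes>\<^bsub>B\<^esub> d \<otimes>\<^bsub>B\<^esub> inv\<^bsub>B\<^esub> b \<in> C'"
      using B.index_2_conj[OF C' assms(2)] bd by blast
    then show ?thesis unfolding eq by (subst amalgam_factors_outside(2)) auto
  qed
  let ?S = "{g \<in> carrier G. \<forall>c\<in>\<iota> ` C. g \<otimes>\<^bsub>G\<^esub> c \<otimes>\<^bsub>G\<^esub> inv\<^bsub>G\<^esub> g \<in> \<iota> ` C}"
  have step: "x \<otimes>\<^bsub>G\<^esub> g \<in> ?S" if x: "x \<in> \<iota> ` carrier A \<union> \<kappa> ` carrier B" and g: "g \<in> ?S" for x g
  proof -
    have xG: "x \<in> carrier G" using x by auto
    have "x \<otimes>\<^bsub>G\<^esub> g \<otimes>\<^bsub>G\<^esub> c \<otimes>\<^bsub>G\<^esub> inv\<^bsub>G\<^esub> (x \<otimes>\<^bsub>G\<^esub> g)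
        = x \<otimes>\<^bsub>G\<^esub> (g \<otimes>\<^bsub>G\<^esub> c \<otimes>\<^bsub>G\<^esub> inv\<^bsub>G\<^esub> g) \<otimes>\<^bsub>G\<^esub> inv\<^bsub>G\<^esub> x" if "c \<in> \<iota> ` C" for c
      using xG g that by (auto simp: G.m_assoc G.inv_mult_group simp del: \<iota>.hom_mult)
    then show ?thesis using xG g gen[OF x] by auto
  qed
  have "carrier G \<subseteq> ?S"
  proof (rule amalgam_carrier_subset)
    show "\<one>\<^bsub>G\<^esub> \<in> ?S" by auto
  qed (rule step; blast)+
  then show ?thesis
    using \<iota>.subgroup_img_is_subgroup[OF C] by (auto simp: G.normal_inv_iff)
qed

text \<open>The sign maps of \<open>A\<close> and \<open>B\<close>, with values in the groups
  generated by the two involutions of \<open>D\<close>, are both trivial on the amalgamated subgroup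
  and so induce \<open>p\<close>. Surjectivity holds because both involutions are hit.\<close>

lemma amalgam_extension_if_index_2:
  assumes A2: "card (rcosets\<^bsub>A\<^esub> C) = 2" and B2: "card (rcosets\<^bsub>B\<^esub> C') = 2"
    and D: "D = free_product (integer_mod_group 2) (integer_mod_group 2)"
  shows "\<exists>p. group_extension (A\<lparr>carrier := C\<rparr>) \<iota> G p D"
proof -
  let ?Z = "integer_mod_group 2"
  let ?\<alpha> = "fpi_inl ?Z ?Z {} 1" and ?\<beta> = "fpi_inr ?Z ?Z {} 1"
  interpret D: two_involutions D ?\<alpha> ?\<beta> unfolding D by (rule two_involutions_free_product)
  interpret N: normal "\<iota> ` C" G by (rule amalgam_normal_if_index_2[OF A2 B2])
  let ?Q = "G Mod \<iota> ` C" and ?q = "\<lambda>g. \<iota> ` C #>\<^bsub>G\<^esub> g"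
  interpret Q: group ?Q by (rule N.factorgroup_is_group)
  have q: "?q \<in> hom G ?Q" by (rule N.r_coset_hom_Mod)
  have q_one: "?q g = \<one>\<^bsub>?Q\<^esub> \<longleftrightarrow> g \<in> \<iota> ` C" if "g \<in> carrier G" for g
    using that G.coset_join1[of "\<iota> ` C"] G.coset_join2[of _ "\<iota> ` C"] N.subgroup_axioms N.subset by auto

  define f g where "f a = (if a \<in> C then \<one>\<^bsub>D\<^esub> else ?\<alpha>)" and "g b = (if b \<in> C' then \<one>\<^bsub>D\<^esub> else ?\<beta>)" for a b
  have f: "f \<in> hom A D" unfolding f_def
    by (rule A.index_2_hom[OF C _ D.group_axioms D.\<alpha>]) (rule A.index_2_mult[OF C A2])
  have g: "g \<in> hom B D" unfolding g_def
    by (rule B.index_2_hom[OF C' _ D.group_axioms D.\<beta>]) (rule B.index_2_mult[OF C' B2])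
  have fg: "f c = g d" if "(c, d) \<in> R" for c d
    using that \<phi>_image by (auto simp: f_def g_def)
  obtain p where p: "p \<in> hom G D" "\<And>a. a \<in> carrier A \<Longrightarrow> p (\<iota> a) = f a"
      "\<And>b. b \<in> carrier B \<Longrightarrow> p (\<kappa> b) = g b"
  proof (rule fpi_universal[OF A B D.group_axioms f g, of R,
        folded amalgamated_product_def amalg_inl_def], goal_cases)
    case (1 c d)
    then show ?case by (simp add: fg del: imageE)
  next
    case (2 h)
    from 2(2-4) show ?case by (rule that[of h])
  qed
  interpret p: group_hom G D p by unfold_locales (rule p(1))

  obtain a0 b0 where a0: "a0 \<in> carrier A" "a0 \<notin> C" and b0: "b0 \<in> carrier B" "b0 \<notin> C'"
    using A.index_2_proper[OF C A2] B.index_2_proper[OF C' B2] C.subset C'.subset by blast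
  \<comment> \<open>A map \<open>D \<rightarrow> G / C\<close> through which the quotient map factors shows that the kernel of \<open>p\<close> is
    not larger than \<open>C\<close>.\<close>
  define u where "u x n = (if n \<in> {0::int} then \<one>\<^bsub>?Q\<^esub> else ?q x)" for x n
  \<comment> \<open>\<open>{0}\<close> plays the subgroup in \<open>index_2_hom\<close>, which turns
    \<open>u x\<close> into a homomorphism; hence membership in \<open>{0}\<close> instead of
    equality with 0.\<close>
  have Z_mult: "x \<otimes>\<^bsub>?Z\<^esub> y \<in> {0}" if "x \<in> carrier ?Z" "y \<in> carrier ?Z" "x \<notin> {0}" "y \<notin> {0}" for x y
    using that by (simp add: integer_mod_group_def) presburger
  have Z_sub: "subgroup {0} ?Z"
    using group.triv_subgroup[OF group_integer_mod_group[of 2]] by simp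
  have u: "u x \<in> hom ?Z ?Q" if x: "x \<in> carrier G" "x \<otimes>\<^bsub>G\<^esub> x \<in> \<iota> ` C" for x
    unfolding u_def
  proof (rule group.index_2_hom[OF group_integer_mod_group Z_sub Z_mult Q.group_axioms])
    show "?q x \<in> carrier ?Q" using hom_in_carrier[OF q x(1)] .
    show "?q x \<otimes>\<^bsub>?Q\<^esub> ?q x = \<one>\<^bsub>?Q\<^esub>"
      using hom_mult[OF q x(1) x(1)] q_one[of "x \<otimes>\<^bsub>G\<^esub> x"] x by simp
  qed
  have "\<iota> a0 \<otimes>\<^bsub>G\<^esub> \<iota> a0 \<in> \<iota> ` C" "\<kappa> b0 \<otimes>\<^bsub>G\<^esub> \<kappa> b0 \<in> \<iota> ` C"
    using A.index_2_mult[OF C A2, of a0 a0] B.index_2_mult[OF C' B2, of b0 b0] a0 b0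
      amalgam_factors_outside(2)[of "b0 \<otimes>\<^bsub>B\<^esub> b0"] by (auto simp flip: \<iota>.hom_mult \<kappa>.hom_mult)
  then have u': "u (\<iota> a0) \<in> hom ?Z ?Q" "u (\<kappa> b0) \<in> hom ?Z ?Q" using u a0 b0 by auto
  obtain s where s: "s \<in> hom D ?Q" "\<And>n. n \<in> carrier ?Z \<Longrightarrow> s (fpi_inl ?Z ?Z {} n) = u (\<iota> a0) n"
      "\<And>n. n \<in> carrier ?Z \<Longrightarrow> s (fpi_inr ?Z ?Z {} n) = u (\<kappa> b0) n"
  proof (rule fpi_universal[OF group_integer_mod_group[of 2] group_integer_mod_group[of 2]
        Q.group_axioms u', of "{}"], goal_cases)
    case (2 h)
    from 2(2-4) show ?case unfolding free_product_def[symmetric] D[symmetric] by (rule that[of h])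
  qed simp
  interpret s: group_hom D ?Q s by unfold_locales (rule s(1))
  have s_gen: "s ?\<alpha> = ?q (\<iota> a0)" "s ?\<beta> = ?q (\<kappa> b0)" using s(2,3)[of 1] by (simp_all add: u_def)
  have sp_hom: "s \<circ> p \<in> hom G ?Q" by (rule hom_compose[OF p(1) s(1)])
  have same_coset: "?q x = ?q y"
    if xy: "x \<in> carrier G" "y \<in> carrier G" "x \<otimes>\<^bsub>G\<^esub> inv\<^bsub>G\<^esub> y \<in> \<iota> ` C" for x y
  proof -
    have "?q (x \<otimes>\<^bsub>G\<^esub> inv\<^bsub>G\<^esub> y) \<otimes>\<^bsub>?Q\<^esub> ?q y = ?q (x \<otimes>\<^bsub>G\<^esub> inv\<^bsub>G\<^esub> y \<otimes>\<^bsub>G\<^esub> y)"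
      using xy by (intro hom_mult[OF q, symmetric]) auto
    moreover have "?q (x \<otimes>\<^bsub>G\<^esub> inv\<^bsub>G\<^esub> y) = \<one>\<^bsub>?Q\<^esub>" using q_one xy by simp
    ultimately show ?thesis using xy hom_in_carrier[OF q xy(2)] by (simp add: G.m_assoc del: mult_FactGroup one_FactGroup)
  qed
  have sp_A: "(s \<circ> p) (\<iota> a) = ?q (\<iota> a)" if a: "a \<in> carrier A" for a
  proof (cases "a \<in> C")
    case True
    then show ?thesis using a p(2) q_one[of "\<iota> a"] s.hom_one by (simp add: f_def)
  next
    case False
    have "\<iota> a0 \<otimes>\<^bsub>G\<^esub> inv\<^bsub>G\<^esub> \<iota> a \<in> \<iota> ` C"
      using A.index_2_mult[OF C A2, of a0 "inv\<^bsub>A\<^esub> a"] a a0 False C.m_inv_closed[of "inv\<^bsub>A\<^esub> a"]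
      by (auto simp flip: \<iota>.hom_inv \<iota>.hom_mult)
    then show ?thesis using a a0 False p(2) s_gen same_coset[of "\<iota> a0" "\<iota> a"] by (simp add: f_def)
  qed
  have sp_B: "(s \<circ> p) (\<kappa> b) = ?q (\<kappa> b)" if b: "b \<in> carrier B" for b
  proof (cases "b \<in> C'")
    case True
    then show ?thesis
      using b p(3) q_one[of "\<kappa> b"] amalgam_factors_outside(2) s.hom_one by (simp add: g_def)
  next
    case False
    then have "b0 \<otimes>\<^bsub>B\<^esub> inv\<^bsub>B\<^esub> b \<in> C'"
      using B.index_2_mult[OF C' B2, of b0 "inv\<^bsub>B\<^esub> b"] b b0 C'.m_inv_closed[of "inv\<^bsub>B\<^esub> b"] by auto
    then have "\<kappa> b0 \<otimes>\<^bsub>G\<^esub> inv\<^bsub>G\<^esub> \<kappa> b \<in> \<iota> ` C"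
      using b b0 amalgam_factors_outside(2)[of "b0 \<otimes>\<^bsub>B\<^esub> inv\<^bsub>B\<^esub> b"]
      by (simp flip: \<kappa>.hom_inv \<kappa>.hom_mult)
    then show ?thesis using b b0 False p(3) s_gen same_coset[of "\<kappa> b0" "\<kappa> b"] by (simp add: g_def)
  qed
  have q_ident: "?q (\<iota> c) = ?q (\<kappa> d)" if "(c, d) \<in> R" for c d
    using that amalgam_identified by auto
  have comp: "?q \<circ> \<iota> \<in> hom A ?Q" "?q \<circ> \<kappa> \<in> hom B ?Q"
    using hom_compose[OF \<iota>_hom q] hom_compose[OF \<kappa>_hom q] by auto
  \<comment> \<open>Only the uniqueness part of the universal property is kept:
    \<open>s \<circ> p\<close> and the quotient map agree on both factors, so both equal
    \<open>h\<close>.\<close>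
  obtain h where h: "\<And>h' x. h' \<in> hom G ?Q \<Longrightarrow> x \<in> carrier G \<Longrightarrow>
      (\<And>a. a \<in> carrier A \<Longrightarrow> h' (\<iota> a) = ?q (\<iota> a)) \<Longrightarrow>
      (\<And>b. b \<in> carrier B \<Longrightarrow> h' (\<kappa> b) = ?q (\<kappa> b)) \<Longrightarrow> h' x = h x"
  proof (rule fpi_universal[OF A B Q.group_axioms comp, of R,
        folded amalgamated_product_def amalg_inl_def], goal_cases)
    case (1 c d)
    then show ?case by (simp add: q_ident del: imageE)
  next
    case (2 h)
    from 2(5) show ?case by (intro 2(1)[of h]) simp
  qed
  have factor: "(s \<circ> p) x = ?q x" if "x \<in> carrier G" for x
    using h[OF sp_hom that sp_A sp_B] h[OF q that] by simp

  have "kernel G D p = \<iota> ` C"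
  proof
    show "kernel G D p \<subseteq> \<iota> ` C"
    proof
      fix x assume "x \<in> kernel G D p"
      then show "x \<in> \<iota> ` C" using factor[of x] q_one[of x] s.hom_one by (simp add: kernel_def)
    qed
    show "\<iota> ` C \<subseteq> kernel G D p" using p(2) by (auto simp: kernel_def f_def)
  qed
  moreover have "p ` carrier G = carrier D"
  proof
    have "?\<alpha> = p (\<iota> a0)" "?\<beta> = p (\<kappa> b0)" using p a0 b0 by (simp_all add: f_def g_def)
    then have mult: "?\<alpha> \<otimes>\<^bsub>D\<^esub> p x = p (\<iota> a0 \<otimes>\<^bsub>G\<^esub> x)" "?\<beta> \<otimes>\<^bsub>D\<^esub> p x = p (\<kappa> b0 \<otimes>\<^bsub>G\<^esub> x)"
      if "x \<in> carrier G" for x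
      using that a0 b0 by simp_all
    show "carrier D \<subseteq> p ` carrier G"
    proof (rule D.generated)
      show "\<one>\<^bsub>D\<^esub> \<in> p ` carrier G" using p.hom_one by (metis G.one_closed imageI)
    qed (use a0 b0 in \<open>auto simp: mult simp del: p.hom_mult\<close>)
  qed auto
  moreover have "group_hom (A\<lparr>carrier := C\<rparr>) G \<iota>"
    using C.subgroup_is_group[OF A] \<iota>_hom
    by (auto simp: group_hom_def group_hom_axioms_def hom_def G.group_axioms)
  ultimately have "group_extension (A\<lparr>carrier := C\<rparr>) \<iota> G p D"
    by (simp add: group_extension_def p.group_hom_axioms inj_on_amalg_inl)
  then show ?thesis by blast
qed

end

section \<open>The icc criterion for amalgamated products\<close>

theorem proposition5p14:
  fixes A :: "('a, 'm) monoid_scheme" and B :: "('b, 'n) monoid_scheme"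
    and C :: "'a set" and C' :: "'b set" and \<phi> :: "'a \<Rightarrow> 'b"
  assumes "group A" and "group B"
    and "subgroup C A" and "C \<noteq> carrier A"
    and "subgroup C' B" and "C' \<noteq> carrier B"
    and "\<phi> \<in> iso (A\<lparr>carrier := C\<rparr>) (B\<lparr>carrier := C'\<rparr>)"
    and G: "G = amalgamated_product A B C \<phi>"
    and \<iota>: "\<iota> = amalg_inl A B C \<phi>"
    and Ct: "Ct = largest_normal_within G (\<iota> ` C)"
    and D: "D = free_product (integer_mod_group 2) (integer_mod_group 2)"
  shows "(\<not> degenerate_amalgam A B C C' \<longrightarrow> (icc G \<longleftrightarrow> FC G Ct = {\<one>\<^bsub>G\<^esub>})) \<and>
    (degenerate_amalgam A B C C' \<longrightarrow>
      Ct = \<iota> ` C \<and>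
      (\<exists>p. group_extension (A\<lparr>carrier := C\<rparr>) \<iota> G p D) \<and>
      (\<forall>p. group_extension (A\<lparr>carrier := C\<rparr>) \<iota> G p D \<longrightarrow>
        (icc G \<longleftrightarrow>
          FC G Ct = {\<one>\<^bsub>G\<^esub>} \<and> inj_on (coupling (A\<lparr>carrier := C\<rparr>) \<iota> G p) (carrier D))))"
proof -
  note amalgam_assms = assms(1-3,5,7)
  define \<kappa> where "\<kappa> = fpi_inr A B ((\<lambda>c. (c, \<phi> c)) ` C)"
  define H where "H s = (if s then \<iota> ` carrier A else \<kappa> ` carrier B)" for s
  obtain type_word where "amalgam G H (\<iota> ` C) type_word"
    using amalgamated_product_amalgam[OF amalgam_assms assms(4,6)]
    unfolding G \<iota> \<kappa>_def H_def by blast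
  then interpret amalgam G H "\<iota> ` C" type_word .
  note outside = amalgam_factors_outside[OF amalgam_assms, folded \<iota> \<kappa>_def]
  note Ct_facts = largest_normal_within_eq[OF is_group C, folded Ct]
  have one: "\<one>\<^bsub>G\<^esub> \<in> FC G Ct"
    using subgroup.one_closed[OF normal_imp_subgroup[OF Ct_facts(2)]] Ct_facts(1)
    by (simp add: FC_def conj_class_one)
  have FC: "FC G Ct = {\<one>\<^bsub>G\<^esub>}" if "icc G"
  proof -
    have "Ct \<subseteq> carrier G" using Ct_facts(1) by auto
    with that one show ?thesis by (auto simp: icc_def FC_def)
  qed
  have icc: "icc G" if nondeg: "\<not> degenerate_amalgam A B C C'" and FC: "FC G Ct = {\<one>\<^bsub>G\<^esub>}"
  proof -
    \<comment> \<open>Non-degeneracy provides a factor whose index is not 2;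
      \<open>not_index_2_avoid\<close> there gives the condition of
      \<open>infinite_conj_class_outside_C\<close>.\<close>
    have "\<exists>r. \<forall>x\<in>H r - \<iota> ` C. \<exists>y\<in>H r - \<iota> ` C. y \<otimes>\<^bsub>G\<^esub> x \<notin> \<iota> ` C"
    proof (cases "card (rcosets\<^bsub>A\<^esub> C) = 2")
      case False
      interpret hom: group_hom A G \<iota>
        using fpi_inl_hom[OF assms(1,2)] assms(1) is_group
        by (simp add: group_hom_def group_hom_axioms_def G \<iota> amalgamated_product_def amalg_inl_def)
      have "\<exists>y\<in>\<iota> ` carrier A - \<iota> ` C. y \<otimes>\<^bsub>G\<^esub> x \<notin> \<iota> ` C" if x: "x \<in> \<iota> ` carrier A - \<iota> ` C" for x
      proof -
        obtain a where a: "a \<in> carrier A" "a \<notin> C" "x = \<iota> a" using x by blast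
        then obtain a' where a': "a' \<in> carrier A - C" "a' \<otimes>\<^bsub>A\<^esub> a \<notin> C"
          using group.not_index_2_avoid[OF assms(1,3) False] by blast
        then have "\<iota> (a' \<otimes>\<^bsub>A\<^esub> a) \<notin> \<iota> ` C" using a(1) by (subst outside(1)) auto
        with a a' show ?thesis by (intro bexI[of _ "\<iota> a'"]) (simp_all add: outside(1))
      qed
      then show ?thesis by (intro exI[of _ True]) (simp add: H_def)
    next
      case True
      then have False: "card (rcosets\<^bsub>B\<^esub> C') \<noteq> 2" using nondeg by (simp add: degenerate_amalgam_def)
      interpret hom: group_hom B G \<kappa>
        using fpi_inr_hom[OF assms(1,2)] assms(2) is_group
        by (simp add: group_hom_def group_hom_axioms_def G \<kappa>_def amalgamated_product_def)
      have "\<exists>y\<in>\<kappa> ` carrier B - \<iota> ` C. y \<otimes>\<^bsub>G\<^esub> x \<notin> \<iota> ` C" if x: "x \<in> \<kappa> ` carrier B - \<iota> ` C" for x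
      proof -
        obtain b where b: "b \<in> carrier B" "b \<notin> C'" "x = \<kappa> b" using x outside(2) by blast
        then obtain b' where b': "b' \<in> carrier B - C'" "b' \<otimes>\<^bsub>B\<^esub> b \<notin> C'"
          using group.not_index_2_avoid[OF assms(2,5) False] by blast
        then have "\<kappa> (b' \<otimes>\<^bsub>B\<^esub> b) \<notin> \<iota> ` C" using b(1) by (subst outside(2)) auto
        with b b' show ?thesis by (intro bexI[of _ "\<kappa> b'"]) (simp_all add: outside(2))
      qed
      then show ?thesis by (intro exI[of _ False]) (simp add: H_def)
    qed
    then obtain r where r: "\<And>x. x \<in> H r - \<iota> ` C \<Longrightarrow> \<exists>y\<in>H r - \<iota> ` C. y \<otimes>\<^bsub>G\<^esub> x \<notin> \<iota> ` C"
      by blast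
    have "x = \<one>\<^bsub>G\<^esub>" if x: "x \<in> carrier G" "finite (conj_class G x)" for x
    proof -
      \<comment> \<open>Every conjugate of \<open>x\<close> has the same finite class and so lies in
        the image of \<open>C\<close>; by the explicit form of the largest normal subgroup,
        \<open>x\<close> is in \<open>Ct\<close>.\<close>
      have "g \<otimes>\<^bsub>G\<^esub> x \<otimes>\<^bsub>G\<^esub> inv\<^bsub>G\<^esub> g \<in> \<iota> ` C" if "g \<in> carrier G" for g
        using infinite_conj_class_outside_C[OF r, of "g \<otimes>\<^bsub>G\<^esub> x \<otimes>\<^bsub>G\<^esub> inv\<^bsub>G\<^esub> g"] x that
        by (auto simp: conj_class_conj)
      then have "x \<in> FC G Ct" using x Ct_facts(1) by (simp add: FC_def)
      with FC show ?thesis by simp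
    qed
    then show ?thesis using infinite_carrier by (auto simp: icc_def)
  qed
  have Ct_C: "Ct = \<iota> ` C" if "degenerate_amalgam A B C C'"
    using Ct_facts(3,4) amalgam_normal_if_index_2[OF amalgam_assms, folded G \<iota>] that
    by (metis Ct_facts(1) degenerate_amalgam_def order_refl subset_antisym)
  have deg: "icc G \<longleftrightarrow> FC G Ct = {\<one>\<^bsub>G\<^esub>} \<and> inj_on (coupling (A\<lparr>carrier := C\<rparr>) \<iota> G p) (carrier D)"
    if "degenerate_amalgam A B C C'" and p: "group_extension (A\<lparr>carrier := C\<rparr>) \<iota> G p D" for p
  proof
    assume "icc G"
    with FC icc_imp_coupling_inj[OF p] two_involutions_free_product[folded D]
    show "FC G Ct = {\<one>\<^bsub>G\<^esub>} \<and> inj_on (coupling (A\<lparr>carrier := C\<rparr>) \<iota> G p) (carrier D)" by blast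
  next
    assume "FC G Ct = {\<one>\<^bsub>G\<^esub>} \<and> inj_on (coupling (A\<lparr>carrier := C\<rparr>) \<iota> G p) (carrier D)"
    then show "icc G"
      using infinite_conj_class_if_coupling_inj[OF p] infinite_carrier Ct_C[OF that(1)]
      by (auto simp: icc_def)
  qed
  show ?thesis
    using FC icc Ct_C deg amalgam_extension_if_index_2[OF amalgam_assms _ _ D, folded G \<iota>]
    unfolding degenerate_amalgam_def by blast
qed

end
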